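(* Let $\alpha,\beta>-1$, let $x\in(0,1)$, let $(q_n)$ be a sequence in $(0,1)$, and let $f$ be a real function continuous at the point $x$. Then $$\lim_{n\to\infty}M_{n,q_n}^{\alpha,\beta}f(x)=f(x)$$ in each of the two following cases: 1. $f$ is bounded on $[0,1]$ and $\lim_{n\to\infty}q_n=1$; 2. there exist real numbers $\alpha',\beta'\ge0$ and $\kappa'>0$ such that $|t^{\alpha'}(1-t)^{\beta'}f(t)|\le\kappa'$ for all $t\in(0,1)$, $\alpha'<\alpha+1$, $\beta'<\beta+1$, and the sequence $(q_n)$ has property $S$.
   Context: Property $S$ of a sequence $(q_n)$ in $(0,1)$: there exist $N\in\mathbb N$ and $c>0$ such that $1-q_n<c/n$ for all $n>N$. For $q\in(0,1)$ and real $a$, $[a]_q=\frac{1-q^a}{1-q}$; $[n]_q!=\prod_{j=1}^n[j]_q$; $\begin{bmatrix}n\\k\end{bmatrix}_q=\frac{[n]_q!}{[k]_q!\,[n-k]_q!}$. For real $a$, $(1-x)_q^a=\prod_{j=0}^\infty\frac{1-q^jx}{1-q^{j+a}x}$. The Jackson integral is $\int_0^ah(t)\,d_qt=a(1-q)\sum_{i\ge0}q^ih(q^ia)$. Put $b_{n,k,q}(x)=\begin{bmatrix}n\\k\end{bmatrix}_qx^k(1-x)_q^{n-k}$, $0\le k\le n$, and $$M_{n,q}^{\alpha,\beta}f(x)=\sum_{k=0}^n f_{n,k,q}^{\alpha,\beta}\,b_{n,k,q}(x),\qquad f_{n,k,q}^{\alpha,\beta}=\frac{\int_0^1t^{k+\alpha}(1-qt)_q^{n-k+\beta}f(q^{\beta+1}t)\,d_qt}{\int_0^1t^{k+\alpha}(1-qt)_q^{n-k+\beta}\,d_qt}.$$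 Only the values of $f$ in $(0,1)$ are used. *)

theory Defs
  imports "HOL-Analysis.Analysis"
begin

definition property_S :: "(nat \<Rightarrow> real) \<Rightarrow> bool" where
  "property_S q \<longleftrightarrow> (\<exists>N::nat. \<exists>c>0. \<forall>n>N. 1 - q n < c / real n)"

definition q_number :: "real \<Rightarrow> real \<Rightarrow> real" where
  "q_number q a = (1 - q powr a) / (1 - q)"

definition q_fact :: "real \<Rightarrow> nat \<Rightarrow> real" where
  "q_fact q n = (\<Prod>j=1..n. q_number q (real j))"

definition q_binomial :: "real \<Rightarrow> nat \<Rightarrow> nat \<Rightarrow> real" where
  "q_binomial q n k = q_fact q n / (q_fact q k * q_fact q (n - k))"

text \<open>\<^term>\<open>q_power q x a\<close> is the \<open>q\<close>-analogue of \<open>(1 - x)\<close> to the real power \<open>a\<close>. It is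
  used below for \<open>0 < q < 1\<close>, \<open>x < 1\<close> and \<open>q powr a * x < 1\<close>, so that no factor has a vanishing
  numerator or denominator and the product converges.\<close>

definition q_power :: "real \<Rightarrow> real \<Rightarrow> real \<Rightarrow> real" where
  "q_power q x a = (\<Prod>j. (1 - q ^ j * x) / (1 - q powr (real j + a) * x))"

definition jackson_integral :: "real \<Rightarrow> real \<Rightarrow> (real \<Rightarrow> real) \<Rightarrow> real" where
  "jackson_integral q a h = a * (1 - q) * (\<Sum>i. q ^ i * h (q ^ i * a))"

definition q_bernstein :: "nat \<Rightarrow> nat \<Rightarrow> real \<Rightarrow> real \<Rightarrow> real" where
  "q_bernstein n k q x = q_binomial q n k * x ^ k * q_power q x (real (n - k))"

definition q_jacobi_coeff ::
    "real \<Rightarrow> real \<Rightarrow> nat \<Rightarrow> nat \<Rightarrow> real \<Rightarrow> (real \<Rightarrow> real) \<Rightarrow> real" where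
  "q_jacobi_coeff \<alpha> \<beta> n k q f =
     jackson_integral q 1
       (\<lambda>t. t powr (real k + \<alpha>) * q_power q (q * t) (real (n - k) + \<beta>) * f (q powr (\<beta> + 1) * t))
     / jackson_integral q 1
       (\<lambda>t. t powr (real k + \<alpha>) * q_power q (q * t) (real (n - k) + \<beta>))"

definition q_durrmeyer ::
    "real \<Rightarrow> real \<Rightarrow> nat \<Rightarrow> real \<Rightarrow> (real \<Rightarrow> real) \<Rightarrow> real \<Rightarrow> real" where
  "q_durrmeyer \<alpha> \<beta> n q f x =
     (\<Sum>k=0..n. q_jacobi_coeff \<alpha> \<beta> n k q f * q_bernstein n k q x)"

end

theory Submission
  imports Defs
begin

text \<open>The operator \<open>f \<mapsto> M f x\<close> is a double average. The coefficient with index \<open>k\<close> is the mean of \<open>f\<close> under a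
  discrete \<open>q\<close>-beta distribution with parameters \<open>k + \<alpha> + 1\<close> and \<open>n - k + \<beta> + 1\<close>, carried by the points
  \<open>q\<^sup>\<beta>\<^sup>+\<^sup>1\<^sup>+\<^sup>i\<close>; these means are then averaged over \<open>k\<close> with the \<open>q\<close>-binomial weights \<open>b\<^bsub>n, k\<^esub>(x)\<close>, which are
  positive and sum to \<open>1\<close>. The inner distribution is centred at \<open>[k] / [n]\<close> with an error of order
  \<open>1 / [n] + (1 - q\<^sup>\<beta>\<^sup>+\<^sup>1)\<close>, and \<open>[k] / [n]\<close> has mean \<open>x\<close> and variance \<open>x (1 - x) / [n]\<close>. As \<open>q\<^sub>n\<close> tends to \<open>1\<close>,
  \<open>[n]\<close> tends to infinity, so the whole average concentrates at \<open>x\<close>. For bounded \<open>f\<close> this gives the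
  theorem by the estimate \<open>\<bar>f t - f x\<bar> \<le> e + K (t - x)\<^sup>2\<close> of Korovkin type.

  For the second case choose exponents \<open>a\<close> with \<open>\<alpha>' < a < \<alpha> + 1\<close> and \<open>b\<close> with \<open>\<beta>' < b < \<beta> + 1\<close> and put
  \<open>H t = t\<^sup>-\<^sup>a + (1 - t)\<^sup>-\<^sup>b\<close>. Close to the endpoints \<open>f\<close> is below any positive multiple of \<open>H\<close>, so
  \<open>\<bar>f t - f x\<bar> \<le> e + K (t - x)\<^sup>2 + e H t\<close>, and it is enough that \<open>M H x\<close> stays bounded
  (\<open>q_durrmeyer_tendsto\<close>). The mean of \<open>t\<^sup>-\<^sup>a\<close> is a quotient of \<open>q\<close>-beta functions. The recursions of the
  \<open>q\<close>-beta function, together with the concavity of \<open>u \<mapsto> 1 - q\<^sup>u\<close>, bound it by a constant times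
  \<open>\<Prod>\<^bsub>j<m\<^esub> [n + 1 + j] / [k + 1 + j]\<close> for an integer \<open>m \<ge> a\<close>. Multiplication by this product turns the
  binomial weights of level \<open>n\<close> into those of level \<open>n + m\<close>, divided by \<open>x\<^sup>m\<close>; so the sum over \<open>k\<close> is
  at most \<open>1 / x\<^sup>m\<close>. The singularity at \<open>1\<close> behaves symmetrically, except that the \<open>q\<close>-calculus singles
  out one endpoint: comparing \<open>(1 - t)\<^sup>-\<^sup>b\<close> with its \<open>q\<close>-analogue moves the nodes by up to \<open>m\<close> grid steps and
  costs a factor \<open>q\<close> to the power \<open>- m (n + \<alpha> + 1)\<close>. Property \<open>S\<close> keeps this factor bounded.\<close>

section \<open>The infinite q-shifted factorial\<close>

text \<open>The infinite \<open>q\<close>-shifted factorial \<open>(z; q)\<^sub>\<infinity>\<close>. The \<open>q\<close>-powers \<open>(1 - z)\<^sub>q\<^sup>a\<close> are quotients of two of its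
  values, which turns each identity for \<open>q\<close>-powers into one for a single function.\<close>

definition qpoch :: "real \<Rightarrow> real \<Rightarrow> real" where
  "qpoch q z = (\<Prod>j. 1 - q ^ j * z)"

lemma qpow_mult_less_1:
  fixes q z :: real
  assumes "0 < q" "q < 1" "0 \<le> z" "z < 1"
  shows "q ^ j * z < 1" "0 \<le> q ^ j * z"
proof -
  have "q ^ j * z \<le> 1 * z"
    using assms by (intro mult_right_mono power_le_one) auto
  then show "q ^ j * z < 1" using assms by simp
qed (use assms in auto)

lemma one_minus_mult_expand: "(1 - a) * (1 - b) = 1 - (a + b) + a * (b :: real)"
  by (simp add: algebra_simps)

context
  fixes q :: real
  assumes q: "0 < q" "q < 1"
begin

lemma qpoch_has_prod: "(\<lambda>j. 1 - q ^ j * z) has_prod qpoch q z"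
proof -
  have "summable (\<lambda>j. q ^ j * \<bar>z\<bar>)"
    using q by (intro summable_mult2 summable_geometric) auto
  then have "summable (\<lambda>j. norm ((1 - q ^ j * z) - 1))"
    using q by (simp add: abs_mult)
  then have "convergent_prod (\<lambda>j. 1 - q ^ j * z)"
    by (intro abs_convergent_prod_imp_convergent_prod summable_imp_abs_convergent_prod)
  then show ?thesis unfolding qpoch_def by (rule convergent_prod_has_prod)
qed

lemma qpoch_tendsto: "(\<lambda>n. \<Prod>j<n. 1 - q ^ j * z) \<longlonglongrightarrow> qpoch q z"
  by (rule has_prod_imp_tendsto'[OF qpoch_has_prod])

lemma qpoch_pos: assumes "0 \<le> z" "z < 1" shows "0 < qpoch q z"
  using has_prod_pos[OF qpoch_has_prod, of z] qpow_mult_less_1[OF q assms] by simp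

lemma qpoch_antimono: assumes "0 \<le> z" "z \<le> w" "w < 1" shows "qpoch q w \<le> qpoch q z"
proof (rule LIMSEQ_le[OF qpoch_tendsto qpoch_tendsto], intro exI allI impI prod_mono conjI)
  fix j show "0 \<le> 1 - q ^ j * w" using qpow_mult_less_1(1)[OF q, of w j] assms by simp
  show "1 - q ^ j * w \<le> 1 - q ^ j * z" using assms q by (simp add: mult_left_mono)
qed

lemma qpoch_le_1: assumes "0 \<le> z" "z < 1" shows "qpoch q z \<le> 1"
proof -
  have "qpoch q 0 = 1" by (simp add: qpoch_def)
  then show ?thesis using qpoch_antimono[of 0 z] assms by simp
qed

lemma qpoch_rec: "qpoch q z = (1 - z) * qpoch q (q * z)"
proof -
  have "(\<lambda>n. \<Prod>j<Suc n. 1 - q ^ j * z) \<longlonglongrightarrow> qpoch q z"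
    using qpoch_tendsto by (rule LIMSEQ_Suc)
  moreover have "(\<Prod>j<Suc n. 1 - q ^ j * z) = (1 - z) * (\<Prod>j<n. 1 - q ^ j * (q * z))" for n
    unfolding prod.lessThan_Suc_shift by (simp add: mult_ac)
  moreover have "(\<lambda>n. (1 - z) * (\<Prod>j<n. 1 - q ^ j * (q * z))) \<longlonglongrightarrow> (1 - z) * qpoch q (q * z)"
    by (intro tendsto_mult tendsto_const qpoch_tendsto)
  ultimately show ?thesis using LIMSEQ_unique by simp
qed

lemma qpoch_split: "qpoch q z = (\<Prod>j<m. 1 - q ^ j * z) * qpoch q (q ^ m * z)"
proof (induction m)
  case (Suc m)
  then show ?case using qpoch_rec[of "q ^ m * z"] by (simp add: mult_ac)
qed simp

text \<open>Every factor satisfies the inequality, because \<open>(1 - a) (1 - b) = 1 - (a + b) + a b\<close> and the product of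
  the two arguments is kept fixed. This controls how ratios of \<open>q\<close>-shifted factorials change when both
  arguments are moved along the \<open>q\<close>-grid.\<close>

lemma qpoch_exchange:
  assumes "0 \<le> u" "u < 1" "0 \<le> v" "v < 1" "0 \<le> s" "s < 1" "0 \<le> t" "t < 1"
    and "u * v = s * t" and "s + t \<le> u + v"
  shows "qpoch q u * qpoch q v \<le> qpoch q s * qpoch q t"
proof (rule LIMSEQ_le[OF tendsto_mult[OF qpoch_tendsto qpoch_tendsto]
        tendsto_mult[OF qpoch_tendsto qpoch_tendsto]], intro exI allI impI)
  fix n :: nat
  have "(\<Prod>j<n. (1 - q ^ j * u) * (1 - q ^ j * v)) \<le> (\<Prod>j<n. (1 - q ^ j * s) * (1 - q ^ j * t))"
  proof (intro prod_mono conjI)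
    fix j
    show "0 \<le> (1 - q ^ j * u) * (1 - q ^ j * v)"
      using qpow_mult_less_1(1)[OF q, of u j] qpow_mult_less_1(1)[OF q, of v j] assms by simp
    have "q ^ j * (s + t) \<le> q ^ j * (u + v)" using assms q by (intro mult_left_mono) auto
    moreover have "(q ^ j * u) * (q ^ j * v) = (q ^ j * s) * (q ^ j * t)"
      using assms by (simp add: mult_ac)
    ultimately show "(1 - q ^ j * u) * (1 - q ^ j * v) \<le> (1 - q ^ j * s) * (1 - q ^ j * t)"
      unfolding one_minus_mult_expand distrib_left by linarith
  qed
  then show "(\<Prod>j<n. 1 - q ^ j * u) * (\<Prod>j<n. 1 - q ^ j * v)
      \<le> (\<Prod>j<n. 1 - q ^ j * s) * (\<Prod>j<n. 1 - q ^ j * t)"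
    by (simp add: prod.distrib)
qed

text \<open>Weighted arithmetic-geometric mean inequalities for \<open>1 - u, 1 - v\<close> and for \<open>u, v\<close>; the two arithmetic
  means add up to \<open>1\<close>.\<close>

lemma one_minus_geometric_mean:
  fixes u v l :: real
  assumes "0 < u" "u < 1" "0 < v" "v < 1" "0 \<le> l" "l \<le> 1"
  shows "(1 - u) powr (1 - l) * (1 - v) powr l \<le> 1 - u powr (1 - l) * v powr l"
  using Youngs_inequality_0[of "1 - l" l "1 - u" "1 - v"]
    Youngs_inequality_0[of "1 - l" l u v] assms by (simp add: algebra_simps)

text \<open>Inherited from the factors through the previous lemma, since the weighted geometric mean of
  \<open>q\<^sup>j u\<close> and \<open>q\<^sup>j v\<close> is \<open>q\<^sup>j\<close> times that of \<open>u\<close> and \<open>v\<close>. It gives access to shifts by a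
  non-integer exponent from shifts by an integer.\<close>

lemma qpoch_log_concave:
  assumes "0 < u" "u < 1" "0 < v" "v < 1" "0 \<le> l" "l \<le> 1"
  shows "qpoch q u powr (1 - l) * qpoch q v powr l \<le> qpoch q (u powr (1 - l) * v powr l)"
proof (rule LIMSEQ_le[OF _ qpoch_tendsto])
  let ?w = "u powr (1 - l) * v powr l"
  show "(\<lambda>n. (\<Prod>j<n. 1 - q ^ j * u) powr (1 - l) * (\<Prod>j<n. 1 - q ^ j * v) powr l)
      \<longlonglongrightarrow> qpoch q u powr (1 - l) * qpoch q v powr l"
    using qpoch_pos[of u] qpoch_pos[of v] assms
    by (intro tendsto_mult tendsto_powr qpoch_tendsto tendsto_const) auto
  show "\<exists>N. \<forall>n\<ge>N. (\<Prod>j<n. 1 - q ^ j * u) powr (1 - l) * (\<Prod>j<n. 1 - q ^ j * v) powr l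
      \<le> (\<Prod>j<n. 1 - q ^ j * ?w)"
  proof (intro exI allI impI)
    fix n :: nat
    have *: "0 < 1 - q ^ j * u" "0 < 1 - q ^ j * v" for j
      using qpow_mult_less_1(1)[OF q, of u j] qpow_mult_less_1(1)[OF q, of v j] assms by auto
    have "(\<Prod>j<n. 1 - q ^ j * u) powr (1 - l) * (\<Prod>j<n. 1 - q ^ j * v) powr l
       = (\<Prod>j<n. (1 - q ^ j * u) powr (1 - l) * (1 - q ^ j * v) powr l)"
      using * by (simp add: prod_powr_distrib prod.distrib less_imp_le)
    also have "\<dots> \<le> (\<Prod>j<n. 1 - q ^ j * ?w)"
    proof (intro prod_mono conjI)
      fix j
      have "(q ^ j * u) powr (1 - l) * (q ^ j * v) powr l
          = (q ^ j) powr (1 - l) * (q ^ j) powr l * ?w"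
        using q assms by (simp add: powr_mult)
      also have "(q ^ j) powr (1 - l) * (q ^ j) powr l = q ^ j"
        using q by (simp flip: powr_add)
      finally show "(1 - q ^ j * u) powr (1 - l) * (1 - q ^ j * v) powr l \<le> 1 - q ^ j * ?w"
        using one_minus_geometric_mean[of "q ^ j * u" "q ^ j * v" l] *[of j] q assms by simp
    qed simp
    finally show "(\<Prod>j<n. 1 - q ^ j * u) powr (1 - l) * (\<Prod>j<n. 1 - q ^ j * v) powr l
      \<le> (\<Prod>j<n. 1 - q ^ j * ?w)" .
  qed
qed

lemma q_power_eq:
  assumes "0 \<le> z" "z < 1" "q powr a * z < 1"
  shows "q_power q z a = qpoch q z / qpoch q (q powr a * z)"
proof -
  have "(\<lambda>j. (1 - q ^ j * z) / (1 - q ^ j * (q powr a * z)))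
      has_prod (qpoch q z / qpoch q (q powr a * z))"
    by (intro has_prod_divide qpoch_has_prod)
  moreover have *: "q powr (real j + a) * z = q ^ j * (q powr a * z)" for j
    using q by (simp add: powr_add powr_realpow)
  ultimately show ?thesis unfolding q_power_def * by (metis has_prod_unique)
qed

lemma q_power_nat:
  assumes "0 \<le> z" "z < 1"
  shows "q_power q z (real m) = (\<Prod>j<m. 1 - q ^ j * z)"
  using qpow_mult_less_1[OF q assms, of m] qpoch_pos[of "q ^ m * z"] qpoch_split[of z m]
    q_power_eq[of z "real m"] q assms by (simp add: powr_realpow)

end

section \<open>Jackson sums of beta type\<close>

text \<open>The \<open>q\<close>-shifted factorial in logarithmic scale; up to the factor \<open>(1 - q)\<^sup>1\<^sup>-\<^sup>c (q; q)\<^sub>\<infinity>\<close> it is the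
  reciprocal of the \<open>q\<close>-Gamma function at \<open>c\<close>, and \<open>qphi_rec\<close> is the functional equation.\<close>

definition qphi :: "real \<Rightarrow> real \<Rightarrow> real" where
  "qphi q c = qpoch q (q powr c)"

text \<open>The mass that the Jackson integral of \<open>t\<^sup>s\<^sup>-\<^sup>1 (1 - q t)\<^sub>q\<^sup>r\<^sup>-\<^sup>1\<close> over \<open>[0, 1]\<close> puts on the node
  \<open>t = q\<^sup>i\<close>, without the common factor \<open>1 - q\<close>. Hence \<open>beta_sum\<close> is the \<open>q\<close>-beta function up to that
  factor.\<close>

definition beta_weight :: "real \<Rightarrow> real \<Rightarrow> real \<Rightarrow> nat \<Rightarrow> real" where
  "beta_weight q s r i = q powr (s * real i) * (qphi q (real i + 1) / qphi q (real i + r))"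

definition beta_sum :: "real \<Rightarrow> real \<Rightarrow> real \<Rightarrow> real" where
  "beta_sum q s r = (\<Sum>i. beta_weight q s r i)"

lemma powr_01:
  fixes q c :: real
  assumes "0 < q" "q < 1" "0 < c"
  shows "0 < q powr c" "q powr c < 1"
  using assms powr_less_mono2[of c q 1] by auto

lemma powr_antimono:
  fixes q c d :: real
  assumes "0 < q" "q < 1" "c \<le> d"
  shows "q powr d \<le> q powr c"
  using assms powr_mono'[of c d q] by auto

context
  fixes q :: real
  assumes q: "0 < q" "q < 1"
begin

text \<open>The function \<open>u \<mapsto> 1 - q\<^sup>u\<close> is increasing, concave and vanishes at \<open>0\<close>. The gain is that the
  constant \<open>C\<close> does not depend on \<open>q\<close>: quotients of \<open>q\<close>-numbers are compared uniformly as \<open>q\<close> tends to \<open>1\<close>.\<close>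

lemma one_minus_powr_le_mult:
  assumes "0 < v" "1 \<le> C" "u \<le> C * v"
  shows "1 - q powr u \<le> C * (1 - q powr v)"
proof -
  let ?y = "q powr v"
  have y: "0 < ?y" using q by simp
  have "1 - q powr u \<le> 1 - ?y powr C"
    using powr_antimono[OF q assms(3)] by (simp add: powr_powr mult.commute)
  moreover have "(?y powr C) powr (1 / C) * 1 powr (1 - 1 / C) \<le> 1 / C * ?y powr C + (1 - 1 / C) * 1"
    using y assms by (intro Youngs_inequality_0) auto
  then have "?y \<le> ?y powr C / C + (1 - 1 / C)"
    using y assms by (simp add: powr_powr)
  then have "C * ?y \<le> C * (?y powr C / C + (1 - 1 / C))"
    using assms by (intro mult_left_mono) auto
  then have "C * ?y \<le> ?y powr C + C - 1"
    using assms by (simp add: algebra_simps)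
  ultimately show ?thesis by (simp add: algebra_simps)
qed

lemma qphi_pos: "0 < c \<Longrightarrow> 0 < qphi q c"
  using powr_01[OF q, of c] qpoch_pos[OF q] by (simp add: qphi_def)

lemma qphi_le_1: "0 < c \<Longrightarrow> qphi q c \<le> 1"
  using powr_01[OF q, of c] qpoch_le_1[OF q] by (simp add: qphi_def)

lemma qphi_mono: "0 < c \<Longrightarrow> c \<le> d \<Longrightarrow> qphi q c \<le> qphi q d"
  using powr_01[OF q, of c] powr_antimono[OF q, of c d] qpoch_antimono[OF q]
  by (simp add: qphi_def)

lemma qphi_rec: "qphi q c = (1 - q powr c) * qphi q (c + 1)"
  using qpoch_rec[OF q, of "q powr c"] q by (simp add: qphi_def powr_add mult.commute)

lemma qphi_split: "qphi q c = (\<Prod>j<m. 1 - q powr (c + real j)) * qphi q (c + real m)"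
  using qpoch_split[OF q, of "q powr c" m] q
  by (simp add: qphi_def powr_add powr_realpow mult.commute)

lemma q_power_eq_qphi:
  assumes "0 < c" "0 < c + a"
  shows "q_power q (q powr c) a = qphi q c / qphi q (c + a)"
  using q_power_eq[OF q, of "q powr c" a] powr_01[OF q assms(1)] powr_01[OF q assms(2)]
  by (simp add: qphi_def powr_add mult.commute)

lemma qphi_exchange:
  assumes "0 < c" "0 < c'" "0 \<le> d" "0 \<le> d'" "(q powr c - q powr c') * (q powr d - q powr d') \<ge> 0"
  shows "qphi q (c + d) * qphi q (c' + d') \<le> qphi q (c' + d) * qphi q (c + d')"
  unfolding qphi_def
proof (rule qpoch_exchange[OF q])
  show "q powr (c' + d) + q powr (c + d') \<le> q powr (c + d) + q powr (c' + d')"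
    using assms(5) by (simp add: powr_add algebra_simps)
qed (use assms powr_01[OF q] in \<open>auto simp: powr_add[symmetric] add_ac\<close>)

text \<open>The left-hand side is \<open>(1 - q\<^sup>c)\<^sub>q\<^sup>b\<close>, which for integer \<open>b = m\<close> is a product of \<open>m\<close> factors below
  \<open>1 - q\<^sup>c\<^sup>+\<^sup>m\<close>. Logarithmic concavity interpolates between \<open>b = 0\<close> and \<open>b = m\<close>.\<close>

lemma qphi_ratio_le_powr:
  assumes "0 < c" "0 < b" "b \<le> real m"
  shows "qphi q c / qphi q (c + b) \<le> (1 - q powr (c + real m)) powr b"
proof -
  define l where "l = b / real m"
  have m: "0 < real m" using assms by simp
  have l: "0 \<le> l" "l \<le> 1" "l * real m = b" using assms m by (auto simp: l_def)
  have pos: "0 < qphi q c" "0 < qphi q (c + real m)" using assms by (auto intro!: qphi_pos)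
  have "(q powr c) powr (1 - l) * (q powr (c + real m)) powr l
      = q powr (c * (1 - l) + (c + real m) * l)"
    unfolding powr_powr powr_add[symmetric] ..
  also have "c * (1 - l) + (c + real m) * l = c + b"
    using l(3) by (simp add: algebra_simps)
  finally have "qphi q c powr (1 - l) * qphi q (c + real m) powr l \<le> qphi q (c + b)"
    using qpoch_log_concave[OF q, of "q powr c" "q powr (c + real m)" l] l
      powr_01[OF q, of c] powr_01[OF q, of "c + real m"] assms by (simp add: qphi_def)
  then have "qphi q c / qphi q (c + b) \<le> qphi q c / (qphi q c powr (1 - l) * qphi q (c + real m) powr l)"
    using pos by (intro divide_left_mono mult_pos_pos) (auto intro!: qphi_pos assms add_pos_pos)
  also have "\<dots> = (qphi q c / qphi q (c + real m)) powr l"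
    using pos by (simp add: powr_diff powr_divide)
  finally have *: "qphi q c / qphi q (c + b) \<le> (qphi q c / qphi q (c + real m)) powr l" .
  have "qphi q c / qphi q (c + real m) = (\<Prod>j<m. 1 - q powr (c + real j))"
    using qphi_split[of c m] pos by simp
  also have "\<dots> \<le> (\<Prod>j<m. 1 - q powr (c + real m))"
  proof (intro prod_mono conjI)
    fix j assume "j \<in> {..<m}"
    then show "1 - q powr (c + real j) \<le> 1 - q powr (c + real m)"
      using powr_antimono[OF q, of "c + real j" "c + real m"] by simp
    show "0 \<le> 1 - q powr (c + real j)"
      using powr_01[OF q, of "c + real j"] assms by simp
  qed
  also have "\<dots> = (1 - q powr (c + real m)) powr real m"
    using powr_01[OF q, of "c + real m"] assms by (simp add: powr_realpow)
  finally have "(qphi q c / qphi q (c + real m)) powr l \<le> ((1 - q powr (c + real m)) powr real m) powr l"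
    using l(1) pos by (intro powr_mono2) auto
  with * show ?thesis using l(3) by (simp add: powr_powr mult.commute)
qed

lemma beta_weight_pos: "0 < r \<Longrightarrow> 0 < beta_weight q s r i"
  using q by (simp add: beta_weight_def qphi_pos)

lemma summable_beta_weight:
  assumes "0 < s" "0 < r"
  shows "summable (beta_weight q s r)"
proof (rule summable_comparison_test'[where N = 0])
  show "summable (\<lambda>i. (q powr s) ^ i * (1 / qphi q r))"
    using powr_01[OF q assms(1)] by (intro summable_mult2 summable_geometric) auto
  fix i :: nat
  have "qphi q (real i + 1) / qphi q (real i + r) \<le> 1 / qphi q r"
    using assms by (intro frac_le qphi_le_1 qphi_mono qphi_pos) auto
  moreover have "q powr (s * real i) = (q powr s) ^ i"
    using q by (simp add: powr_powr[symmetric] powr_realpow)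
  ultimately have "beta_weight q s r i \<le> (q powr s) ^ i * (1 / qphi q r)"
    unfolding beta_weight_def by (metis mult_left_mono powr_ge_zero)
  then show "norm (beta_weight q s r i) \<le> (q powr s) ^ i * (1 / qphi q r)"
    using beta_weight_pos[OF assms(2), of s i] by simp
qed

lemma beta_sum_pos: "0 < s \<Longrightarrow> 0 < r \<Longrightarrow> 0 < beta_sum q s r"
  unfolding beta_sum_def by (intro suminf_pos summable_beta_weight beta_weight_pos)

lemma beta_sum_antimono:
  assumes "0 < s" "s \<le> s'" "0 < r" "r \<le> r'"
  shows "beta_sum q s' r' \<le> beta_sum q s r"
  unfolding beta_sum_def
proof (intro suminf_le summable_beta_weight)
  fix i
  have "q powr (s' * real i) \<le> q powr (s * real i)"
    using assms by (intro powr_antimono[OF q] mult_right_mono) auto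
  moreover have "qphi q (real i + 1) / qphi q (real i + r') \<le> qphi q (real i + 1) / qphi q (real i + r)"
    using assms by (intro divide_left_mono qphi_mono) (auto intro!: qphi_pos mult_pos_pos less_imp_le)
  ultimately show "beta_weight q s' r' i \<le> beta_weight q s r i"
    unfolding beta_weight_def using assms
    by (intro mult_mono) (auto intro!: divide_nonneg_pos qphi_pos less_imp_le[OF qphi_pos])
qed (use assms in auto)

lemma beta_weight_shift_s: "beta_weight q (s + d) r i = q powr (d * real i) * beta_weight q s r i"
  by (simp add: beta_weight_def powr_add distrib_right)

text \<open>\<open>q\<close>-integration by parts: the increments of \<open>t\<^sup>s (1 - t)\<^sub>q\<^sup>r\<close> along the nodes sum to \<open>0\<close>, as this
  function vanishes at \<open>t = 1\<close> and tends to \<open>0\<close> at \<open>t = 0\<close>.\<close>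

lemma beta_sum_rec_s:
  assumes "0 < s" "0 < r"
  shows "(1 - q powr s) * beta_sum q s r = (1 - q powr (s + r)) * beta_sum q (s + 1) r"
proof -
  \<comment> \<open>The value of \<open>t\<^sup>s (1 - t)\<^sub>q\<^sup>r\<close> at \<open>t = q\<^sup>i\<close>, with the factor \<open>1 - t\<close> taken out.\<close>
  define G where "G i = (1 - q powr real i) * beta_weight q s r i" for i
  have sm: "summable (beta_weight q s r)" "summable (beta_weight q (s + 1) r)"
    using assms by (auto intro: summable_beta_weight)
  have w0: "beta_weight q s r \<longlonglongrightarrow> 0" by (rule summable_LIMSEQ_zero[OF sm(1)])
  have "G \<longlonglongrightarrow> 0"
  proof (rule Lim_null_comparison[OF _ w0], rule always_eventually, rule allI)
    fix i
    have "0 \<le> 1 - q powr real i" "1 - q powr real i \<le> 1"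
      using powr_antimono[OF q, of 0 "real i"] q by auto
    then show "norm (G i) \<le> beta_weight q s r i"
      using beta_weight_pos[OF assms(2), of s i]
      by (simp add: G_def abs_mult mult_left_le_one_le)
  qed
  then have "(\<lambda>i. G (Suc i) - G i) sums (0 - G 0)"
    by (rule telescope_sums)
  moreover have "G (Suc i) - G i
     = (1 - q powr (s + r)) * beta_weight q (s + 1) r i - (1 - q powr s) * beta_weight q s r i" for i
  proof -
    have p: "1 - q powr (real i + r) \<noteq> 0" "qphi q (real i + r + 1) \<noteq> 0"
      using powr_01[OF q, of "real i + r"] qphi_pos[of "real i + r + 1"] assms by auto
    have r1: "qphi q (real i + 1) = (1 - q powr (real i + 1)) * qphi q (real i + 2)"
      using qphi_rec[of "real i + 1"] by (simp add: add.assoc)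
    have r2: "qphi q (real i + r) = (1 - q powr (real i + r)) * qphi q (real i + r + 1)"
      by (rule qphi_rec)
    have "G (Suc i) = q powr s * q powr (s * real i)
        * ((1 - q powr (real i + 1)) * qphi q (real i + 2)) / qphi q (real i + r + 1)"
      unfolding G_def beta_weight_def
      by (simp add: algebra_simps powr_add)
    also have "\<dots> = q powr s * q powr (s * real i) * qphi q (real i + 1) / qphi q (real i + r + 1)"
      using r1 by simp
    also have "\<dots> = q powr s * (1 - q powr (real i + r)) * beta_weight q s r i"
      unfolding beta_weight_def r2 using p by simp
    finally have *: "G (Suc i) = q powr s * (1 - q powr (real i + r)) * beta_weight q s r i" .
    show ?thesis
      unfolding * unfolding G_def beta_weight_shift_s[of s 1]
      by (simp add: algebra_simps powr_add)
  qed
  moreover have "(\<lambda>i. (1 - q powr (s + r)) * beta_weight q (s + 1) r i - (1 - q powr s) * beta_weight q s r i)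
    sums ((1 - q powr (s + r)) * beta_sum q (s + 1) r - (1 - q powr s) * beta_sum q s r)"
    unfolding beta_sum_def by (intro sums_diff sums_mult summable_sums sm)
  ultimately have "0 - G 0
      = (1 - q powr (s + r)) * beta_sum q (s + 1) r - (1 - q powr s) * beta_sum q s r"
    by (simp add: sums_unique2)
  then show ?thesis using q by (simp add: G_def)
qed

text \<open>Raising \<open>r\<close> multiplies the integrand by \<open>1 - q\<^sup>r t\<close>, so this reduces to the recursion in \<open>s\<close>.\<close>

lemma beta_sum_rec_r:
  assumes "0 < s" "0 < r"
  shows "(1 - q powr r) * beta_sum q s r = (1 - q powr (s + r)) * beta_sum q s (r + 1)"
proof -
  have "beta_weight q s (r + 1) i
      = beta_weight q s r i - q powr r * beta_weight q (s + 1) r i" for i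
  proof -
    have p: "1 - q powr (real i + r) \<noteq> 0" "qphi q (real i + r + 1) \<noteq> 0"
      using powr_01[OF q, of "real i + r"] qphi_pos[of "real i + r + 1"] assms by auto
    have r2: "qphi q (real i + r) = (1 - q powr (real i + r)) * qphi q (real i + r + 1)"
      by (rule qphi_rec)
    have "beta_weight q s (r + 1) i = (1 - q powr (real i + r)) * beta_weight q s r i"
      unfolding beta_weight_def add.assoc[symmetric] r2 using p by simp
    then show ?thesis
      unfolding beta_weight_shift_s[of s 1] by (simp add: algebra_simps powr_add)
  qed
  then have *: "beta_weight q s (r + 1)
      = (\<lambda>i. beta_weight q s r i - q powr r * beta_weight q (s + 1) r i)"
    by (rule ext)
  have "(\<lambda>i. beta_weight q s r i - q powr r * beta_weight q (s + 1) r i)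
      sums (beta_sum q s r - q powr r * beta_sum q (s + 1) r)"
    unfolding beta_sum_def
    by (intro sums_diff sums_mult summable_sums summable_beta_weight) (use assms in auto)
  then have eq: "beta_sum q s (r + 1) = beta_sum q s r - q powr r * beta_sum q (s + 1) r"
    unfolding beta_sum_def[of q s "r + 1"] * by (rule sums_unique[symmetric])
  have "(1 - q powr (s + r)) * beta_sum q s (r + 1)
     = (1 - q powr (s + r)) * beta_sum q s r - q powr r * ((1 - q powr (s + r)) * beta_sum q (s + 1) r)"
    unfolding eq by algebra
  also have "\<dots> = (1 - q powr (s + r)) * beta_sum q s r - q powr r * ((1 - q powr s) * beta_sum q s r)"
    using beta_sum_rec_s[OF assms] by simp
  finally show ?thesis by (simp add: algebra_simps powr_add)
qed

lemma beta_sum_iter_s: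
  assumes "0 < s" "0 < r"
  shows "(\<Prod>j<m. 1 - q powr (s + real j)) * beta_sum q s r
      = (\<Prod>j<m. 1 - q powr (s + r + real j)) * beta_sum q (s + real m) r"
proof (induction m)
  case (Suc m)
  have "(\<Prod>j<Suc m. 1 - q powr (s + real j)) * beta_sum q s r
     = (1 - q powr (s + real m)) * ((\<Prod>j<m. 1 - q powr (s + r + real j)) * beta_sum q (s + real m) r)"
    using Suc by (simp add: mult_ac)
  also have "\<dots> = (\<Prod>j<m. 1 - q powr (s + r + real j)) * ((1 - q powr (s + real m)) * beta_sum q (s + real m) r)"
    by (simp add: mult_ac)
  also have "(1 - q powr (s + real m)) * beta_sum q (s + real m) r
      = (1 - q powr (s + real m + r)) * beta_sum q (s + real m + 1) r"
    using assms by (intro beta_sum_rec_s) auto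
  finally show ?case by (simp add: algebra_simps)
qed simp

lemma beta_sum_iter_r:
  assumes "0 < s" "0 < r"
  shows "(\<Prod>j<m. 1 - q powr (r + real j)) * beta_sum q s r
      = (\<Prod>j<m. 1 - q powr (s + r + real j)) * beta_sum q s (r + real m)"
proof (induction m)
  case (Suc m)
  have "(\<Prod>j<Suc m. 1 - q powr (r + real j)) * beta_sum q s r
     = (1 - q powr (r + real m)) * ((\<Prod>j<m. 1 - q powr (s + r + real j)) * beta_sum q s (r + real m))"
    using Suc by (simp add: mult_ac)
  also have "\<dots> = (\<Prod>j<m. 1 - q powr (s + r + real j)) * ((1 - q powr (r + real m)) * beta_sum q s (r + real m))"
    by (simp add: mult_ac)
  also have "(1 - q powr (r + real m)) * beta_sum q s (r + real m)
      = (1 - q powr (s + (r + real m))) * beta_sum q s (r + real m + 1)"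
    using assms by (intro beta_sum_rec_r) auto
  finally show ?case by (simp add: algebra_simps)
qed simp

text \<open>The recursion lifts the parameter \<open>s\<close> by the integer \<open>m\<close> past \<open>s'\<close>, and the beta sum decreases in this
  parameter. The quotient of \<open>q\<close>-beta functions with a non-integer difference is thereby bounded by
  elementary factors.\<close>

lemma beta_sum_lower_s:
  assumes "0 < s" "0 < r" "s' \<le> s + real m" "0 < s'"
  shows "beta_sum q s r / beta_sum q s' r
      \<le> (\<Prod>j<m. (1 - q powr (s + r + real j)) / (1 - q powr (s + real j)))" 
proof -
  have pos: "0 < (\<Prod>j<m. 1 - q powr (s + real j))" "0 < (\<Prod>j<m. 1 - q powr (s + r + real j))"
    using powr_01[OF q] assms by (auto intro!: prod_pos)
  have "(\<Prod>j<m. 1 - q powr (s + real j)) * beta_sum q s r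
      \<le> (\<Prod>j<m. 1 - q powr (s + r + real j)) * beta_sum q s' r"
    unfolding beta_sum_iter_s[OF assms(1,2)] using pos assms
    by (intro mult_left_mono beta_sum_antimono) auto
  then show ?thesis
    unfolding prod_dividef using pos beta_sum_pos[OF assms(4,2)] by (simp add: field_simps)
qed

lemma beta_sum_lower_r:
  assumes "0 < s" "0 < r" "r' \<le> r + real m" "0 < r'"
  shows "beta_sum q s r / beta_sum q s r'
      \<le> (\<Prod>j<m. (1 - q powr (s + r + real j)) / (1 - q powr (r + real j)))" 
proof -
  have pos: "0 < (\<Prod>j<m. 1 - q powr (r + real j))" "0 < (\<Prod>j<m. 1 - q powr (s + r + real j))"
    using powr_01[OF q] assms by (auto intro!: prod_pos)
  have "(\<Prod>j<m. 1 - q powr (r + real j)) * beta_sum q s r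
      \<le> (\<Prod>j<m. 1 - q powr (s + r + real j)) * beta_sum q s r'"
    unfolding beta_sum_iter_r[OF assms(1,2)] using pos assms
    by (intro mult_left_mono beta_sum_antimono) auto
  then show ?thesis
    unfolding prod_dividef using pos beta_sum_pos[OF assms(1,4)] by (simp add: field_simps)
qed

text \<open>The extra factor is \<open>1 / (1 - q t)\<^sub>q\<^sup>b\<close>, a \<open>q\<close>-analogue of the singularity \<open>(1 - t)\<^sup>-\<^sup>b\<close>. It cancels the first part of
  \<open>(1 - q t)\<^sub>q\<^sup>r\<^sup>+\<^sup>b\<^sup>-\<^sup>1\<close> and leaves \<open>(1 - q\<^sup>b\<^sup>+\<^sup>1 t)\<^sub>q\<^sup>r\<^sup>-\<^sup>1\<close>, an integrand of parameter \<open>r\<close> at nodes shifted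
  by \<open>b\<close>. Moving the nodes back to the grid by \<open>m\<close> steps costs the factor \<open>q\<^sup>-\<^sup>m\<^sup>s\<close>, which is large when
  \<open>s\<close> is of order \<open>n\<close>; property \<open>S\<close> is what keeps it bounded.\<close>

lemma beta_weight_divide_qphi_ratio_le:
  assumes "0 < s" "0 < r" "0 < b" "b \<le> real m"
  defines "w \<equiv> (\<lambda>i. beta_weight q s (r + b) i * (qphi q (real i + 1 + b) / qphi q (real i + 1)))"
  shows "summable w" and "suminf w \<le> q powr - (real m * s) * beta_sum q s r"
proof -
  have w: "w i = q powr (s * real i) * (qphi q (real i + 1 + b) / qphi q (real i + r + b))" for i
    using qphi_pos[of "real i + 1"] by (simp add: w_def beta_weight_def add_ac)
  have w0: "0 \<le> w i" for i
    unfolding w using assms by (auto intro!: mult_nonneg_nonneg divide_nonneg_pos less_imp_le[OF qphi_pos] qphi_pos)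
  have big: "1 \<le> q powr - (real m * s)"
    using powr_antimono[OF q, of "- (real m * s)" 0] assms q by simp
  have "summable w \<and> suminf w \<le> q powr - (real m * s) * beta_sum q s r"
  proof (cases "1 \<le> r")
    case True
    \<comment> \<open>For \<open>r \<ge> 1\<close> the factor \<open>(1 - q\<^sup>b\<^sup>+\<^sup>1 t)\<^sub>q\<^sup>r\<^sup>-\<^sup>1\<close> is nonincreasing in \<open>t\<close>, so replacing \<open>b\<close> by \<open>m\<close> does not lower it.\<close>
    have le: "w i \<le> q powr - (real m * s) * beta_weight q s r (i + m)" for i
    proof -
      have "qphi q ((real i + b) + 1) * qphi q ((real i + m) + r)
          \<le> qphi q ((real i + m) + 1) * qphi q ((real i + b) + r)"
        using assms True powr_antimono[OF q, of "real i + b" "real i + m"] powr_antimono[OF q, of 1 r]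
        by (intro qphi_exchange mult_nonneg_nonneg) auto
      then have "qphi q (real i + 1 + b) / qphi q (real i + r + b)
          \<le> qphi q (real (i + m) + 1) / qphi q (real (i + m) + r)"
        using qphi_pos[of "real i + r + b"] qphi_pos[of "real (i + m) + r"] assms
        by (simp add: field_simps)
      moreover have "q powr (s * real i) = q powr - (real m * s) * q powr (s * real (i + m))"
        by (simp add: powr_add[symmetric] algebra_simps)
      ultimately show ?thesis
        unfolding w beta_weight_def by (metis mult_left_mono mult.assoc powr_ge_zero)
    qed
    have sm: "summable (\<lambda>i. q powr - (real m * s) * beta_weight q s r (i + m))"
      using summable_beta_weight[OF assms(1,2)] by (intro summable_mult) (simp add: summable_iff_shift)
    have sw: "summable w"
      by (rule summable_comparison_test'[OF sm, of 0]) (use le w0 in auto)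
    have "suminf w \<le> (\<Sum>i. q powr - (real m * s) * beta_weight q s r (i + m))"
      by (rule suminf_le[OF le sw sm])
    also have "\<dots> = q powr - (real m * s) * (\<Sum>i. beta_weight q s r (i + m))"
      using summable_beta_weight[OF assms(1,2)] by (intro suminf_mult) (simp add: summable_iff_shift)
    also have "(\<Sum>i. beta_weight q s r (i + m)) \<le> beta_sum q s r"
      unfolding beta_sum_def suminf_split_initial_segment[OF summable_beta_weight[OF assms(1,2)], of m]
      by (simp add: sum_nonneg less_imp_le[OF beta_weight_pos[OF assms(2)]])
    finally show ?thesis using sw by (simp add: mult_left_mono)
  next
    case False
    \<comment> \<open>For \<open>r < 1\<close> the factor \<open>(1 - q\<^sup>b\<^sup>+\<^sup>1 t)\<^sub>q\<^sup>r\<^sup>-\<^sup>1\<close> increases in \<open>t\<close>, so it grows when the shift is dropped.\<close>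
    have le: "w i \<le> beta_weight q s r i" for i
    proof -
      have "qphi q (real i + 1 + b) / qphi q (real i + r + b) \<le> qphi q (real i + 1) / qphi q (real i + r)"
      proof -
        have "(q powr (r + b) - q powr r) * (q powr real i - q powr (real i + (1 - r))) \<le> 0"
          using False powr_antimono[OF q, of r "r + b"] powr_antimono[OF q, of "real i" "real i + (1 - r)"] assms
          by (intro mult_nonpos_nonneg) auto
        then have "qphi q (r + b + (real i + (1 - r))) * qphi q (r + real i)
            \<le> qphi q (r + (real i + (1 - r))) * qphi q (r + b + real i)"
          using assms False by (intro qphi_exchange) (auto simp: algebra_simps)
        then show ?thesis
          using qphi_pos[of "real i + r + b"] qphi_pos[of "real i + r"] assms
          by (simp add: field_simps)
      qed
      then show ?thesis
        unfolding w beta_weight_def by (metis mult_left_mono powr_ge_zero)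
    qed
    have sm: "summable (beta_weight q s r)"
      using summable_beta_weight[OF assms(1,2)] .
    have sw: "summable w"
      by (rule summable_comparison_test'[OF sm, of 0]) (use le w0 in auto)
    have "suminf w \<le> beta_sum q s r" unfolding beta_sum_def
      by (rule suminf_le[OF le sw sm])
    also have "\<dots> \<le> q powr - (real m * s) * beta_sum q s r"
      using big beta_sum_pos[OF assms(1,2)] by simp
    finally show ?thesis using sw by simp
  qed
  then show "summable w" "suminf w \<le> q powr - (real m * s) * beta_sum q s r" by auto
qed

end

section \<open>The q-binomial distribution\<close>

lemma q_number_0: "0 < q \<Longrightarrow> q_number q 0 = 0"
  by (simp add: q_number_def)

lemma q_fact_Suc: "q_fact q (Suc n) = q_number q (real (Suc n)) * q_fact q n"
  by (simp add: q_fact_def mult.commute)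

context
  fixes q :: real
  assumes q: "0 < q" "q < 1"
begin

lemma q_number_nat: "q_number q (real j) = (1 - q ^ j) / (1 - q)"
  using q by (simp add: q_number_def powr_realpow)

lemma q_number_pos: "0 < c \<Longrightarrow> 0 < q_number q c"
  using q powr_01[OF q, of c] by (simp add: q_number_def)

lemma q_number_Suc: "q_number q (real (Suc j)) = 1 + q * q_number q (real j)"
  unfolding q_number_nat using q by (simp add: field_simps)

lemma q_number_add: "q_number q (real (i + j)) = q_number q (real i) + q ^ i * q_number q (real j)"
  unfolding q_number_nat using q by (simp add: field_simps power_add)

lemma q_number_mono: "c \<le> d \<Longrightarrow> q_number q c \<le> q_number q d"
  using powr_antimono[OF q, of c d] q by (simp add: q_number_def divide_right_mono)

text \<open>A fixed shift changes a \<open>q\<close>-number by a bounded amount, uniformly in \<open>q\<close>. This makes the parameters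
  \<open>\<alpha>\<close> and \<open>\<beta>\<close> negligible against \<open>[n]\<^sub>q\<close>.\<close>

lemma q_number_shift:
  assumes "0 < c"
  shows "q_number q (real k) \<le> q_number q (real k + c)"
    "q_number q (real k + c) \<le> q_number q (real k) + (1 + c)"
proof -
  have eq: "q_number q (real k + c) = q_number q (real k) + q ^ k * q_number q c"
    using q by (simp add: q_number_def powr_add powr_realpow field_simps)
  have "1 - q powr c \<le> (1 + c) * (1 - q powr 1)"
    using assms by (intro one_minus_powr_le_mult[OF q]) auto
  then have "q_number q c \<le> 1 + c"
    using q by (simp add: q_number_def field_simps)
  moreover have "0 < q_number q c" by (rule q_number_pos[OF assms])
  moreover have "q ^ k \<le> 1" "0 < q ^ k" using q by (auto intro: power_le_one)
  ultimately have "0 \<le> q ^ k * q_number q c" "q ^ k * q_number q c \<le> 1 * (1 + c)"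
    using mult_mono[of "q ^ k" 1 "q_number q c" "1 + c"] by simp_all
  then show "q_number q (real k) \<le> q_number q (real k + c)"
    "q_number q (real k + c) \<le> q_number q (real k) + (1 + c)"
    unfolding eq by simp_all
qed

lemma q_number_ratio_shift:
  assumes "k \<le> n" "0 < n" "0 < c" "0 < d" "c \<le> d" "1 + c \<le> C" "1 + d \<le> C"
  defines "u \<equiv> q_number q (real k + c) / q_number q (real n + d)"
  shows "\<bar>u - q_number q (real k) / q_number q (real n)\<bar> \<le> C / q_number q (real n)"
    and "0 \<le> u" "u \<le> 1"
proof -
  define N where "N = q_number q (real n)"
  define B where "B = q_number q (real n + d)"
  define K where "K = q_number q (real k)"
  define A where "A = q_number q (real k + c)"
  have N: "0 < N" unfolding N_def using assms by (intro q_number_pos) simp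
  have K: "0 \<le> K" "K \<le> N" unfolding K_def N_def
    using q_number_mono[of 0 "real k"] q_number_mono[of "real k" "real n"] assms q by (auto simp: q_number_0)
  have A: "K \<le> A" "A \<le> K + C" and B: "N \<le> B" "B \<le> N + C"
    unfolding A_def B_def K_def N_def using q_number_shift[OF assms(3), of k] q_number_shift[OF assms(4), of n] assms
    by auto
  have "A \<le> B" unfolding A_def B_def using assms by (intro q_number_mono) simp
  then show "0 \<le> u" "u \<le> 1"
    unfolding u_def A_def[symmetric] B_def[symmetric] using A B N K by auto
  have "u - K / N = (A - K) / B - (K / N) * ((B - N) / B)"
    unfolding u_def A_def[symmetric] B_def[symmetric] using N B by (simp add: field_simps)
  moreover have "0 \<le> (A - K) / B" using A B N by auto
  moreover have "(A - K) / B \<le> C / N" using A B N by (intro frac_le) auto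
  moreover have "0 \<le> (K / N) * ((B - N) / B)" using K B N by auto
  moreover have "(K / N) * ((B - N) / B) \<le> 1 * (C / N)"
    using K B N by (intro mult_mono frac_le) auto
  ultimately show "\<bar>u - q_number q (real k) / q_number q (real n)\<bar> \<le> C / q_number q (real n)"
    unfolding K_def[symmetric] N_def[symmetric] by linarith
qed

text \<open>Replaces non-integer arguments by integers at the cost of constants independent of \<open>q\<close>, as required for
  the summation against the \<open>q\<close>-binomial weights.\<close>

lemma q_number_ratio_le:
  assumes "0 < u'" "1 \<le> C" "u \<le> C * u'" "0 < v" "0 < v'" "1 \<le> D" "v' \<le> D * v"
  shows "(1 - q powr u) / (1 - q powr v) \<le> C * D * (q_number q u' / q_number q v')"
proof -
  have pos: "0 < 1 - q powr u'" "0 < 1 - q powr v" "0 < 1 - q powr v'" 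
    using powr_01[OF q] assms by auto
  have "(1 - q powr u) / (1 - q powr v) \<le> C * (1 - q powr u') / ((1 - q powr v') / D)"
  proof (rule frac_le)
    show "1 - q powr u \<le> C * (1 - q powr u')" by (rule one_minus_powr_le_mult[OF q assms(1-3)])
    show "(1 - q powr v') / D \<le> 1 - q powr v"
      using one_minus_powr_le_mult[OF q assms(4,6,7)] assms(6) by (simp add: field_simps)
  qed (use pos assms in auto)
  also have "\<dots> = C * D * (q_number q u' / q_number q v')"
    using q by (simp add: q_number_def)
  finally show ?thesis .
qed

lemma q_fact_pos: "0 < q_fact q n"
  unfolding q_fact_def by (intro prod_pos ballI q_number_pos) auto

end

context
  fixes q x :: real
  assumes q: "0 < q" "q < 1" and x: "0 < x" "x < 1"
begin

lemma q_bernstein_eq: "q_bernstein n k q x = q_binomial q n k * x ^ k * (\<Prod>j<n - k. 1 - q ^ j * x)"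
  using q_power_nat[OF q, of x "n - k"] x by (simp add: q_bernstein_def)

lemma one_minus_qpow_pos: "0 < 1 - q ^ j * x"
  using qpow_mult_less_1(1)[OF q, of x j] x by simp

lemma q_bernstein_pos: "0 < q_bernstein n k q x"
  unfolding q_bernstein_eq q_binomial_def using x
  by (intro mult_pos_pos divide_pos_pos prod_pos q_fact_pos[OF q] one_minus_qpow_pos zero_less_power ballI)

text \<open>The \<open>q\<close>-analogues of \<open>(k + 1) b\<^bsub>n + 1, k + 1\<^esub> = (n + 1) x b\<^bsub>n, k\<^esub>\<close> and of its mirror image
  \<open>(n + 1 - k) b\<^bsub>n + 1, k\<^esub> = (n + 1) (1 - x) b\<^bsub>n, k\<^esub>\<close>. The binomial theorem, the first two moments and the
  negative moments below all follow from these two relations.\<close>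

lemma q_bernstein_absorb_success:
  assumes "k \<le> n"
  shows "q_number q (real (Suc k)) * q_bernstein (Suc n) (Suc k) q x
     = q_number q (real (Suc n)) * (x * q_bernstein n k q x)"
proof -
  have "q_number q (real (Suc k)) \<noteq> 0" using q_number_pos[OF q, of "real (Suc k)"] by simp
  then show ?thesis
    unfolding q_bernstein_eq q_binomial_def q_fact_Suc by simp
qed

lemma q_bernstein_absorb_failure:
  assumes "k \<le> n"
  shows "q_number q (real (Suc (n - k))) * q_bernstein (Suc n) k q x
     = q_number q (real (Suc n)) * ((1 - q ^ (n - k) * x) * q_bernstein n k q x)"
proof -
  have "q_number q (real (Suc (n - k))) \<noteq> 0" using q_number_pos[OF q, of "real (Suc (n - k))"] by simp
  moreover have "Suc n - k = Suc (n - k)" using assms by simp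
  ultimately show ?thesis
    unfolding q_bernstein_eq q_binomial_def by (simp add: q_fact_Suc del: of_nat_Suc)
qed

text \<open>The \<open>q\<close>-binomial theorem. In the step from \<open>n\<close> to \<open>n + 1\<close> one writes
  \<open>[n + 1] = [n + 1 - k] + q\<^sup>n\<^sup>+\<^sup>1\<^sup>-\<^sup>k [k]\<close> and absorbs either part into the weights of level \<open>n\<close>; the terms
  with \<open>q\<^sup>n\<^sup>-\<^sup>k x\<close> cancel.\<close>

lemma sum_q_bernstein: "(\<Sum>k\<le>n. q_bernstein n k q x) = 1"
proof (induction n)
  case 0
  show ?case by (simp add: q_bernstein_eq q_binomial_def q_fact_def)
next
  case (Suc n)
  let ?N = "q_number q (real (Suc n))"
  have "?N * (\<Sum>k\<le>Suc n. q_bernstein (Suc n) k q x)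
     = (\<Sum>k\<le>Suc n. q_number q (real (Suc n - k)) * q_bernstein (Suc n) k q x
          + q ^ (Suc n - k) * (q_number q (real k) * q_bernstein (Suc n) k q x))"
    unfolding sum_distrib_left
  proof (intro sum.cong refl)
    fix k assume "k \<in> {..Suc n}"
    then have "?N = q_number q (real (Suc n - k)) + q ^ (Suc n - k) * q_number q (real k)"
      using q_number_add[OF q, of "Suc n - k" k] by simp
    then show "?N * q_bernstein (Suc n) k q x = q_number q (real (Suc n - k)) * q_bernstein (Suc n) k q x
          + q ^ (Suc n - k) * (q_number q (real k) * q_bernstein (Suc n) k q x)"
      by (simp add: algebra_simps)
  qed
  also have "\<dots> = (\<Sum>k\<le>Suc n. q_number q (real (Suc n - k)) * q_bernstein (Suc n) k q x)
      + (\<Sum>k\<le>Suc n. q ^ (Suc n - k) * (q_number q (real k) * q_bernstein (Suc n) k q x))"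
    by (rule sum.distrib)
  also have "(\<Sum>k\<le>Suc n. q_number q (real (Suc n - k)) * q_bernstein (Suc n) k q x)
     = (\<Sum>k\<le>n. q_number q (real (Suc n - k)) * q_bernstein (Suc n) k q x)"
    by (simp add: q_number_0 q)
  also have "\<dots> = (\<Sum>k\<le>n. ?N * ((1 - q ^ (n - k) * x) * q_bernstein n k q x))"
    using q_bernstein_absorb_failure by (intro sum.cong refl) (simp add: Suc_diff_le del: of_nat_Suc)
  also have "(\<Sum>k\<le>Suc n. q ^ (Suc n - k) * (q_number q (real k) * q_bernstein (Suc n) k q x))
     = (\<Sum>k\<le>n. q ^ (n - k) * (q_number q (real (Suc k)) * q_bernstein (Suc n) (Suc k) q x))"
    unfolding sum.atMost_Suc_shift by (simp add: q_number_0 q)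
  also have "\<dots> = (\<Sum>k\<le>n. q ^ (n - k) * (?N * (x * q_bernstein n k q x)))"
    using q_bernstein_absorb_success by (intro sum.cong refl) (simp del: of_nat_Suc)
  also have "(\<Sum>k\<le>n. ?N * ((1 - q ^ (n - k) * x) * q_bernstein n k q x)) + \<dots>
      = (\<Sum>k\<le>n. ?N * q_bernstein n k q x)"
    unfolding sum.distrib[symmetric] by (intro sum.cong refl) (simp add: algebra_simps)
  also have "\<dots> = ?N * 1" unfolding sum_distrib_left[symmetric] Suc ..
  finally show ?case using q_number_pos[OF q, of "real (Suc n)"] by simp
qed

lemma q_bernstein_mean:
  "(\<Sum>k\<le>n. q_number q (real k) * q_bernstein n k q x) = q_number q (real n) * x"
proof (cases n)
  case 0
  then show ?thesis by (simp add: q_number_0 q)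
next
  case (Suc m)
  have "(\<Sum>k\<le>n. q_number q (real k) * q_bernstein n k q x)
      = (\<Sum>k\<le>m. q_number q (real (Suc k)) * q_bernstein (Suc m) (Suc k) q x)"
    unfolding Suc sum.atMost_Suc_shift by (simp add: q_number_0 q)
  also have "\<dots> = (\<Sum>k\<le>m. q_number q (real (Suc m)) * x * q_bernstein m k q x)"
    using q_bernstein_absorb_success by (intro sum.cong refl) (simp del: of_nat_Suc)
  finally show ?thesis unfolding sum_distrib_left[symmetric] sum_q_bernstein Suc by simp
qed

lemma q_bernstein_second_moment:
  "(\<Sum>k\<le>n. (q_number q (real k))\<^sup>2 * q_bernstein n k q x)
     = q_number q (real n) * x * (1 + (q_number q (real n) - 1) * x)"
proof (cases n)
  case 0
  then show ?thesis by (simp add: q_number_0 q)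
next
  case (Suc m)
  let ?N = "q_number q (real (Suc m))"
  have "(\<Sum>k\<le>n. (q_number q (real k))\<^sup>2 * q_bernstein n k q x)
      = (\<Sum>k\<le>m. q_number q (real (Suc k)) * (q_number q (real (Suc k)) * q_bernstein (Suc m) (Suc k) q x))"
    unfolding Suc sum.atMost_Suc_shift by (simp add: q_number_0 q power2_eq_square mult.assoc)
  also have "\<dots> = (\<Sum>k\<le>m. ?N * x * (q_bernstein m k q x + q * (q_number q (real k) * q_bernstein m k q x)))"
    using q_bernstein_absorb_success q_number_Suc[OF q]
    by (intro sum.cong refl) (simp add: algebra_simps del: of_nat_Suc)
  also have "\<dots> = ?N * x * (1 + q * (q_number q (real m) * x))"
    unfolding sum_distrib_left[symmetric] sum.distrib sum_q_bernstein q_bernstein_mean ..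
  finally show ?thesis using q_number_Suc[OF q, of m] Suc by (simp del: of_nat_Suc)
qed

lemma q_bernstein_variance:
  assumes "0 < n"
  shows "(\<Sum>k\<le>n. (q_number q (real k) / q_number q (real n) - x)\<^sup>2 * q_bernstein n k q x)
      = x * (1 - x) / q_number q (real n)"
proof -
  let ?N = "q_number q (real n)"
  have N: "?N \<noteq> 0" using q_number_pos[OF q, of "real n"] assms by simp
  have "(\<Sum>k\<le>n. (q_number q (real k) / ?N - x)\<^sup>2 * q_bernstein n k q x)
    = (\<Sum>k\<le>n. (q_number q (real k))\<^sup>2 * q_bernstein n k q x * (1 / ?N\<^sup>2)
        - q_number q (real k) * q_bernstein n k q x * (2 * x / ?N) + q_bernstein n k q x * x\<^sup>2)"
    using N by (intro sum.cong refl) (simp add: field_simps power2_eq_square)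
  also have "\<dots> = ?N * x * (1 + (?N - 1) * x) * (1 / ?N\<^sup>2) - ?N * x * (2 * x / ?N) + 1 * x\<^sup>2"
    unfolding sum.distrib sum_subtractf sum_distrib_right[symmetric] q_bernstein_second_moment
      q_bernstein_mean sum_q_bernstein ..
  also have "\<dots> = x * (1 - x) / ?N"
    using N by (simp add: field_simps power2_eq_square)
  finally show ?thesis .
qed

text \<open>Iterated absorption. It exhibits the rising product of \<open>[n + 1 + j] / [k + 1 + j]\<close> as the passage from
  the weights of level \<open>n\<close> to those of level \<open>n + m\<close>, whose sum is known.\<close>

lemma q_bernstein_shift_success:
  assumes "k \<le> n"
  shows "(\<Prod>j<m. q_number q (real (n + 1 + j))) * (x ^ m * q_bernstein n k q x)
     = (\<Prod>j<m. q_number q (real (k + 1 + j))) * q_bernstein (n + m) (k + m) q x"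
proof (induction m)
  case (Suc m)
  let ?K = "\<Prod>j<m. q_number q (real (k + 1 + j))"
  have "(\<Prod>j<Suc m. q_number q (real (n + 1 + j))) * (x ^ Suc m * q_bernstein n k q x)
     = q_number q (real (Suc (n + m))) * x *
       ((\<Prod>j<m. q_number q (real (n + 1 + j))) * (x ^ m * q_bernstein n k q x))"
    by (simp add: mult_ac add_ac)
  also have "\<dots> = ?K * (q_number q (real (Suc (n + m))) * (x * q_bernstein (n + m) (k + m) q x))"
    unfolding Suc by (simp add: mult_ac)
  also have "\<dots> = ?K * (q_number q (real (Suc (k + m))) * q_bernstein (Suc (n + m)) (Suc (k + m)) q x)"
    using q_bernstein_absorb_success[of "k + m" "n + m"] assms by simp
  finally show ?case by (simp add: mult_ac add_ac)
qed simp

text \<open>Only an inequality, since the factors \<open>1 - q\<^sup>i x\<close> produced by the absorption depend on \<open>k\<close>; they are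
  bounded below by \<open>1 - x\<close>.\<close>

lemma q_bernstein_shift_failure:
  assumes "k \<le> n"
  shows "(\<Prod>j<m. q_number q (real (n + 1 + j))) * ((1 - x) ^ m * q_bernstein n k q x)
     \<le> (\<Prod>j<m. q_number q (real (n - k + 1 + j))) * q_bernstein (n + m) k q x"
proof (induction m)
  case (Suc m)
  let ?K = "\<Prod>j<m. q_number q (real (n - k + 1 + j))"
  have K: "0 < ?K" by (intro prod_pos ballI q_number_pos[OF q]) simp
  have N: "0 < q_number q (real (Suc (n + m)))" by (intro q_number_pos[OF q]) simp
  have "1 - x \<le> 1 - q ^ (n + m - k) * x"
    using q x by (simp add: mult_left_le_one_le power_le_one)
  then have *: "(1 - x) * q_bernstein (n + m) k q x \<le> (1 - q ^ (n + m - k) * x) * q_bernstein (n + m) k q x"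
    using less_imp_le[OF q_bernstein_pos] by (rule mult_right_mono)
  have "(\<Prod>j<Suc m. q_number q (real (n + 1 + j))) * ((1 - x) ^ Suc m * q_bernstein n k q x)
     = q_number q (real (Suc (n + m))) * (1 - x) *
       ((\<Prod>j<m. q_number q (real (n + 1 + j))) * ((1 - x) ^ m * q_bernstein n k q x))"
    by (simp add: mult_ac add_ac)
  also have "\<dots> \<le> q_number q (real (Suc (n + m))) * (1 - x) * (?K * q_bernstein (n + m) k q x)"
    using N x by (intro mult_left_mono Suc) auto
  also have "\<dots> = ?K * (q_number q (real (Suc (n + m))) * ((1 - x) * q_bernstein (n + m) k q x))"
    by (simp add: mult_ac)
  also have "\<dots> \<le> ?K * (q_number q (real (Suc (n + m)))
       * ((1 - q ^ (n + m - k) * x) * q_bernstein (n + m) k q x))"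
    using K N * by (intro mult_left_mono) auto
  also have "\<dots> = ?K * (q_number q (real (Suc (n + m - k))) * q_bernstein (Suc (n + m)) k q x)"
    using q_bernstein_absorb_failure[of k "n + m"] assms by simp
  also have "Suc (n + m - k) = n - k + 1 + m" using assms by simp
  finally show ?case by (simp add: mult_ac)
qed simp

lemma q_bernstein_negative_moment_success:
  "(\<Sum>k\<le>n. (\<Prod>j<m. q_number q (real (n + 1 + j)) / q_number q (real (k + 1 + j))) * q_bernstein n k q x)
     \<le> 1 / x ^ m"
proof -
  have "(\<Prod>j<m. q_number q (real (n + 1 + j)) / q_number q (real (k + 1 + j))) * q_bernstein n k q x
      = q_bernstein (n + m) (k + m) q x / x ^ m" if "k \<le> n" for k
  proof -
    define K where "K = (\<Prod>j<m. q_number q (real (k + 1 + j)))"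
    have "0 < K" unfolding K_def by (intro prod_pos ballI q_number_pos[OF q]) simp
    then show ?thesis using q_bernstein_shift_success[OF that, of m] x
      unfolding prod_dividef K_def[symmetric] by (simp add: field_simps)
  qed
  then have "(\<Sum>k\<le>n. (\<Prod>j<m. q_number q (real (n + 1 + j)) / q_number q (real (k + 1 + j))) * q_bernstein n k q x)
     = (\<Sum>k\<le>n. q_bernstein (n + m) (k + m) q x) / x ^ m"
    unfolding sum_divide_distrib by (intro sum.cong refl) simp
  also have "(\<Sum>k\<le>n. q_bernstein (n + m) (k + m) q x) = (\<Sum>k\<in>(\<lambda>k. k + m) ` {..n}. q_bernstein (n + m) k q x)"
    by (simp add: sum.reindex)
  also have "\<dots> \<le> (\<Sum>k\<le>n + m. q_bernstein (n + m) k q x)"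
    by (intro sum_mono2) (auto intro: less_imp_le[OF q_bernstein_pos])
  finally show ?thesis using x by (simp add: sum_q_bernstein divide_right_mono)
qed

lemma q_bernstein_negative_moment_failure:
  "(\<Sum>k\<le>n. (\<Prod>j<m. q_number q (real (n + 1 + j)) / q_number q (real (n - k + 1 + j))) * q_bernstein n k q x)
     \<le> 1 / (1 - x) ^ m"
proof -
  have "(\<Prod>j<m. q_number q (real (n + 1 + j)) / q_number q (real (n - k + 1 + j))) * q_bernstein n k q x
      \<le> q_bernstein (n + m) k q x / (1 - x) ^ m" if "k \<le> n" for k
  proof -
    define K where "K = (\<Prod>j<m. q_number q (real (n - k + 1 + j)))"
    have "0 < K" unfolding K_def by (intro prod_pos ballI q_number_pos[OF q]) simp
    then show ?thesis using q_bernstein_shift_failure[OF that, of m] x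
      unfolding prod_dividef K_def[symmetric] by (simp add: field_simps)
  qed
  then have "(\<Sum>k\<le>n. (\<Prod>j<m. q_number q (real (n + 1 + j)) / q_number q (real (n - k + 1 + j))) * q_bernstein n k q x)
     \<le> (\<Sum>k\<le>n. q_bernstein (n + m) k q x) / (1 - x) ^ m"
    unfolding sum_divide_distrib by (intro sum_mono) simp
  also have "(\<Sum>k\<le>n. q_bernstein (n + m) k q x) \<le> (\<Sum>k\<le>n + m. q_bernstein (n + m) k q x)"
    by (intro sum_mono2) (auto intro: less_imp_le[OF q_bernstein_pos])
  finally show ?thesis using x by (simp add: sum_q_bernstein divide_right_mono)
qed

end

section \<open>The coefficients as positive means\<close>

text \<open>Convergence of the series in the numerator of \<open>q_jacobi_coeff\<close>.\<close>

definition jacobi_summable ::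
    "real \<Rightarrow> real \<Rightarrow> nat \<Rightarrow> nat \<Rightarrow> real \<Rightarrow> (real \<Rightarrow> real) \<Rightarrow> bool" where
  "jacobi_summable \<alpha> \<beta> n k q f \<longleftrightarrow>
     summable (\<lambda>i. beta_weight q (real k + \<alpha> + 1) (real (n - k) + \<beta> + 1) i * f (q powr (\<beta> + 1 + real i)))"

text \<open>The substitution \<open>t = q\<^sup>i\<close> in both Jackson integrals: the coefficient is the mean of \<open>f\<close> for the
  normalised beta weights, placed on the nodes \<open>q\<^sup>\<beta>\<^sup>+\<^sup>1\<^sup>+\<^sup>i\<close>, which all lie in \<open>(0, 1)\<close>.\<close>

lemma q_jacobi_coeff_eq:
  assumes q: "0 < q" "q < 1" and \<alpha>: "\<alpha> > -1" and \<beta>: "\<beta> > -1"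
  defines "s \<equiv> (\<lambda>k. real k + \<alpha> + 1)" and "r \<equiv> (\<lambda>l. real l + \<beta> + 1)"
  shows "q_jacobi_coeff \<alpha> \<beta> n k q f
    = (\<Sum>i. beta_weight q (s k) (r (n - k)) i * f (q powr (\<beta> + 1 + real i))) / beta_sum q (s k) (r (n - k))"
proof -
  have *: "q ^ i * ((q ^ i * 1) powr (real k + \<alpha>) * q_power q (q * (q ^ i * 1)) (real (n - k) + \<beta>))
     = beta_weight q (s k) (r (n - k)) i" for i
  proof -
    have "q * (q ^ i * 1) = q powr (real i + 1)"
      using q by (simp add: powr_add powr_realpow)
    moreover have "q_power q (q powr (real i + 1)) (real (n - k) + \<beta>)
        = qphi q (real i + 1) / qphi q (real i + r (n - k))"
      using \<beta> by (subst q_power_eq_qphi[OF q]) (auto simp: r_def add_ac)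
    moreover have "q ^ i * (q ^ i * 1) powr (real k + \<alpha>) = q powr (s k * real i)"
      using q by (simp add: powr_realpow[symmetric] powr_powr powr_add[symmetric] s_def algebra_simps)
    ultimately show ?thesis by (simp add: beta_weight_def)
  qed
  have **: "q powr (\<beta> + 1) * (q ^ i * 1) = q powr (\<beta> + 1 + real i)" for i
    using q by (simp add: powr_add powr_realpow)
  have "q_jacobi_coeff \<alpha> \<beta> n k q f
    = (1 * (1 - q) * (\<Sum>i. beta_weight q (s k) (r (n - k)) i * f (q powr (\<beta> + 1 + real i))))
      / (1 * (1 - q) * beta_sum q (s k) (r (n - k)))"
    unfolding q_jacobi_coeff_def jackson_integral_def beta_sum_def *[symmetric] **[symmetric]
    by (simp only: mult.assoc)
  then show ?thesis using q by simp
qed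

context
  fixes q \<alpha> \<beta> :: real
  assumes q: "0 < q" "q < 1" and \<alpha>: "\<alpha> > -1" and \<beta>: "\<beta> > -1"
begin

lemmas coeff_eq = q_jacobi_coeff_eq[OF q \<alpha> \<beta>]

lemma node_01: "q powr (\<beta> + 1 + real i) \<in> {0<..<1}"
  using powr_01[OF q, of "\<beta> + 1 + real i"] \<beta> by auto

lemma parameters_pos: "0 < real k + \<alpha> + 1" "0 < real l + \<beta> + 1"
  using \<alpha> \<beta> by auto

lemma weight_pos: "0 < beta_weight q s (real l + \<beta> + 1) i"
  by (rule beta_weight_pos[OF q parameters_pos(2)])

lemma norm_pos: "0 < beta_sum q (real k + \<alpha> + 1) (real l + \<beta> + 1)"
  by (rule beta_sum_pos[OF q parameters_pos])

lemma jacobi_summable_const: "jacobi_summable \<alpha> \<beta> n k q (\<lambda>t. c)"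
  unfolding jacobi_summable_def
  by (intro summable_mult2 summable_beta_weight[OF q] parameters_pos)

lemma jacobi_summable_add:
  "jacobi_summable \<alpha> \<beta> n k q f \<Longrightarrow> jacobi_summable \<alpha> \<beta> n k q g \<Longrightarrow>
   jacobi_summable \<alpha> \<beta> n k q (\<lambda>t. f t + g t)"
  unfolding jacobi_summable_def distrib_left by (rule summable_add)

lemma jacobi_summable_cmult:
  "jacobi_summable \<alpha> \<beta> n k q f \<Longrightarrow> jacobi_summable \<alpha> \<beta> n k q (\<lambda>t. c * f t)"
  unfolding jacobi_summable_def mult.left_commute[of _ c] by (rule summable_mult)

lemma jacobi_summable_bounded:
  assumes "jacobi_summable \<alpha> \<beta> n k q g" "\<And>t. t \<in> {0<..<1} \<Longrightarrow> \<bar>f t\<bar> \<le> g t"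
  shows "jacobi_summable \<alpha> \<beta> n k q f"
  unfolding jacobi_summable_def
proof (rule summable_comparison_test'[OF assms(1)[unfolded jacobi_summable_def], of 0])
  fix i
  show "norm (beta_weight q (real k + \<alpha> + 1) (real (n - k) + \<beta> + 1) i * f (q powr (\<beta> + 1 + real i)))
      \<le> beta_weight q (real k + \<alpha> + 1) (real (n - k) + \<beta> + 1) i * g (q powr (\<beta> + 1 + real i))"
    using weight_pos[of "real k + \<alpha> + 1" "n - k" i] assms(2)[OF node_01, of i]
    by (simp add: abs_mult)
qed

lemma q_jacobi_coeff_const: "q_jacobi_coeff \<alpha> \<beta> n k q (\<lambda>t. c) = c"
  unfolding coeff_eq using norm_pos[of k "n - k"]
  by (simp add: beta_sum_def suminf_mult2[symmetric] summable_beta_weight[OF q] parameters_pos)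

lemma q_jacobi_coeff_add:
  "jacobi_summable \<alpha> \<beta> n k q f \<Longrightarrow> jacobi_summable \<alpha> \<beta> n k q g \<Longrightarrow>
   q_jacobi_coeff \<alpha> \<beta> n k q (\<lambda>t. f t + g t) = q_jacobi_coeff \<alpha> \<beta> n k q f + q_jacobi_coeff \<alpha> \<beta> n k q g"
  unfolding coeff_eq jacobi_summable_def distrib_left
  by (simp add: suminf_add[symmetric] add_divide_distrib)

lemma q_jacobi_coeff_cmult:
  "jacobi_summable \<alpha> \<beta> n k q f \<Longrightarrow>
   q_jacobi_coeff \<alpha> \<beta> n k q (\<lambda>t. c * f t) = c * q_jacobi_coeff \<alpha> \<beta> n k q f"
  unfolding coeff_eq jacobi_summable_def mult.left_commute[of _ c]
  by (simp add: suminf_mult)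

lemma q_jacobi_coeff_mono:
  assumes "jacobi_summable \<alpha> \<beta> n k q f" "jacobi_summable \<alpha> \<beta> n k q g"
    "\<And>t. t \<in> {0<..<1} \<Longrightarrow> f t \<le> g t"
  shows "q_jacobi_coeff \<alpha> \<beta> n k q f \<le> q_jacobi_coeff \<alpha> \<beta> n k q g"
  unfolding coeff_eq
proof (intro divide_right_mono suminf_le assms(1,2)[unfolded jacobi_summable_def])
  show "beta_weight q (real k + \<alpha> + 1) (real (n - k) + \<beta> + 1) i * f (q powr (\<beta> + 1 + real i))
      \<le> beta_weight q (real k + \<alpha> + 1) (real (n - k) + \<beta> + 1) i * g (q powr (\<beta> + 1 + real i))" for i
    using weight_pos[of "real k + \<alpha> + 1" "n - k" i] assms(3)[OF node_01, of i] by simp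
qed (rule less_imp_le[OF norm_pos])

text \<open>The mean of a constant is the constant, so positivity transfers a pointwise bound on the deviation
  from \<open>c\<close>.\<close>

lemma q_jacobi_coeff_deviation:
  assumes "jacobi_summable \<alpha> \<beta> n k q g" and le: "\<And>t. t \<in> {0<..<1} \<Longrightarrow> \<bar>f t - c\<bar> \<le> g t"
  shows "\<bar>q_jacobi_coeff \<alpha> \<beta> n k q f - c\<bar> \<le> q_jacobi_coeff \<alpha> \<beta> n k q g"
proof -
  have "jacobi_summable \<alpha> \<beta> n k q (\<lambda>t. f t - c)"
    by (rule jacobi_summable_bounded[OF assms])
  from jacobi_summable_add[OF this jacobi_summable_const, of c]
  have sf: "jacobi_summable \<alpha> \<beta> n k q f" by simp
  note sg = assms(1) and sc = jacobi_summable_const[of n k c]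
  have "q_jacobi_coeff \<alpha> \<beta> n k q f \<le> q_jacobi_coeff \<alpha> \<beta> n k q (\<lambda>t. c + g t)"
    using le by (intro q_jacobi_coeff_mono sf jacobi_summable_add sc sg) (simp add: abs_le_iff algebra_simps)
  moreover have "q_jacobi_coeff \<alpha> \<beta> n k q (\<lambda>t. c) \<le> q_jacobi_coeff \<alpha> \<beta> n k q (\<lambda>t. f t + g t)"
    using le by (intro q_jacobi_coeff_mono sf jacobi_summable_add sc sg) (simp add: abs_le_iff algebra_simps)
  ultimately show ?thesis
    by (simp add: q_jacobi_coeff_add sf sg sc q_jacobi_coeff_const abs_le_iff)
qed

text \<open>A power of \<open>t\<close> is absorbed by the parameter \<open>s\<close> of the beta weights.\<close>

lemma jacobi_power:
  assumes "0 < real k + \<alpha> + 1 + d"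
  shows "jacobi_summable \<alpha> \<beta> n k q (\<lambda>t. t powr d)" (is ?S)
    and "q_jacobi_coeff \<alpha> \<beta> n k q (\<lambda>t. t powr d)
      = q powr (d * (\<beta> + 1)) * (beta_sum q (real k + \<alpha> + 1 + d) (real (n - k) + \<beta> + 1)
          / beta_sum q (real k + \<alpha> + 1) (real (n - k) + \<beta> + 1))" (is ?E)
proof -
  have *: "beta_weight q (real k + \<alpha> + 1) (real (n - k) + \<beta> + 1) i * (q powr (\<beta> + 1 + real i)) powr d
     = q powr (d * (\<beta> + 1)) * beta_weight q (real k + \<alpha> + 1 + d) (real (n - k) + \<beta> + 1) i" for i
  proof -
    have "(\<beta> + 1 + real i) * d = d * (\<beta> + 1) + d * real i" by (simp add: algebra_simps)
    then show ?thesis unfolding beta_weight_shift_s[OF q] powr_powr by (simp add: powr_add)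
  qed
  have sm: "summable (beta_weight q (real k + \<alpha> + 1 + d) (real (n - k) + \<beta> + 1))"
    by (intro summable_beta_weight[OF q] assms parameters_pos)
  show ?S unfolding jacobi_summable_def * by (intro summable_mult sm)
  show ?E unfolding coeff_eq * suminf_mult[OF sm] beta_sum_def by simp
qed

lemma q_jacobi_coeff_mean:
  "q_jacobi_coeff \<alpha> \<beta> n k q (\<lambda>t. t powr 1)
     = q powr (\<beta> + 1) * (q_number q (real k + \<alpha> + 1) / q_number q (real k + real (n - k) + \<alpha> + \<beta> + 2))"
proof -
  define s r where "s = real k + \<alpha> + 1" and "r = real (n - k) + \<beta> + 1"
  have sr: "0 < s" "0 < r" using \<alpha> \<beta> by (auto simp: s_def r_def)
  have e: "s + r = real k + real (n - k) + \<alpha> + \<beta> + 2" by (simp add: s_def r_def)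
  have "beta_sum q (s + 1) r / beta_sum q s r = (1 - q powr s) / (1 - q powr (s + r))"
    using beta_sum_rec_s[OF q sr] beta_sum_pos[OF q sr] powr_01[OF q, of "s + r"] sr
    by (simp add: field_simps)
  then have "beta_sum q (s + 1) r / beta_sum q s r = q_number q s / q_number q (s + r)"
    using q by (simp add: q_number_def)
  then show ?thesis
    using jacobi_power(2)[of k 1 n] \<alpha> unfolding e[symmetric] s_def r_def by simp
qed

lemma q_jacobi_coeff_square:
  "q_jacobi_coeff \<alpha> \<beta> n k q (\<lambda>t. t powr 2)
     = (q powr (\<beta> + 1))\<^sup>2 * ((q_number q (real k + \<alpha> + 1) / q_number q (real k + real (n - k) + \<alpha> + \<beta> + 2))
        * (q_number q (real k + \<alpha> + 2) / q_number q (real k + real (n - k) + \<alpha> + \<beta> + 3)))"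
proof -
  define s r where "s = real k + \<alpha> + 1" and "r = real (n - k) + \<beta> + 1"
  have sr: "0 < s" "0 < s + 1" "0 < r" using \<alpha> \<beta> by (auto simp: s_def r_def)
  have e: "s + r = real k + real (n - k) + \<alpha> + \<beta> + 2" "s + 1 + r = real k + real (n - k) + \<alpha> + \<beta> + 3"
    "s + 1 = real k + \<alpha> + 2"
    by (simp_all add: s_def r_def)
  have "beta_sum q (s + 1) r / beta_sum q s r = (1 - q powr s) / (1 - q powr (s + r))"
    using beta_sum_rec_s[OF q sr(1,3)] beta_sum_pos[OF q sr(1,3)] powr_01[OF q, of "s + r"] sr
    by (simp add: field_simps)
  then have 1: "beta_sum q (s + 1) r / beta_sum q s r = q_number q s / q_number q (s + r)"
    using q by (simp add: q_number_def)
  have "beta_sum q (s + 1 + 1) r / beta_sum q (s + 1) r = (1 - q powr (s + 1)) / (1 - q powr (s + 1 + r))"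
    using beta_sum_rec_s[OF q sr(2,3)] beta_sum_pos[OF q sr(2,3)] powr_01[OF q, of "s + 1 + r"] sr
    by (simp add: field_simps)
  moreover have "s + 1 + 1 = s + 2" by simp
  ultimately have 2: "beta_sum q (s + 2) r / beta_sum q (s + 1) r = q_number q (s + 1) / q_number q (s + 1 + r)"
    using q by (simp add: q_number_def del: add.assoc)
  have "q_jacobi_coeff \<alpha> \<beta> n k q (\<lambda>t. t powr 2)
     = q powr (2 * (\<beta> + 1)) * (beta_sum q (s + 2) r / beta_sum q s r)"
    using jacobi_power(2)[of k 2 n] \<alpha> unfolding s_def r_def by simp
  also have "beta_sum q (s + 2) r / beta_sum q s r
     = (beta_sum q (s + 1) r / beta_sum q s r) * (beta_sum q (s + 2) r / beta_sum q (s + 1) r)"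
    using beta_sum_pos[OF q sr(2,3)] by simp
  also have "q powr (2 * (\<beta> + 1)) = (q powr (\<beta> + 1))\<^sup>2"
    by (simp add: power2_eq_square powr_add[symmetric])
  finally show ?thesis
    unfolding 1 2 unfolding e(1,2) unfolding e(3) unfolding s_def .
qed

text \<open>The first two moments of the coefficient are those of the \<open>q\<close>-beta distribution, scaled by
  \<open>q\<^sup>\<beta>\<^sup>+\<^sup>1\<close>, and agree with the powers of \<open>[k] / [n]\<close> up to errors of order \<open>1 / [n]\<close> and
  \<open>1 - q\<^sup>\<beta>\<^sup>+\<^sup>1\<close>. The error does not depend on \<open>k\<close>.\<close>

lemma jacobi_squared_distance:
  assumes "k \<le> n" "0 < n" "0 \<le> x" "x \<le> 1"
  shows "jacobi_summable \<alpha> \<beta> n k q (\<lambda>t. (t - x)\<^sup>2)"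
    and "q_jacobi_coeff \<alpha> \<beta> n k q (\<lambda>t. (t - x)\<^sup>2)
       \<le> (q_number q (real k) / q_number q (real n) - x)\<^sup>2
         + 4 * ((\<alpha> + \<beta> + 5) / q_number q (real n) + (1 - q powr (\<beta> + 1)))"
proof -
  define p u v Q e where "p = q_number q (real k) / q_number q (real n)"
    and "u = q_number q (real k + (\<alpha> + 1)) / q_number q (real n + (\<alpha> + \<beta> + 2))"
    and "v = q_number q (real k + (\<alpha> + 2)) / q_number q (real n + (\<alpha> + \<beta> + 3))"
    and "Q = q powr (\<beta> + 1)"
    and "e = (\<alpha> + \<beta> + 5) / q_number q (real n)"
  have u: "\<bar>u - p\<bar> \<le> e" "0 \<le> u" "u \<le> 1"
    unfolding u_def p_def e_def using assms \<alpha> \<beta> by (auto intro!: q_number_ratio_shift[OF q, where C = "\<alpha> + \<beta> + 5"])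
  have v: "\<bar>v - p\<bar> \<le> e" "0 \<le> v" "v \<le> 1"
    unfolding v_def p_def e_def using assms \<alpha> \<beta> by (auto intro!: q_number_ratio_shift[OF q, where C = "\<alpha> + \<beta> + 5"])
  have p: "0 \<le> p" "p \<le> 1"
    using q_number_mono[OF q, of 0 "real k"] q_number_mono[OF q, of "real k" "real n"] q_number_pos[OF q, of "real n"] assms q
    by (auto simp: q_number_0 p_def)
  have Q: "0 \<le> Q" "Q \<le> 1" using powr_01[OF q, of "\<beta> + 1"] \<beta> by (auto simp: Q_def)
  have eqn: "real k + real (n - k) = real n" using assms by simp
  have sm: "jacobi_summable \<alpha> \<beta> n k q (\<lambda>t. t powr 1)" "jacobi_summable \<alpha> \<beta> n k q (\<lambda>t. t powr 2)"
    by (rule jacobi_power(1), use \<alpha> in simp)+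
  note sms = jacobi_summable_add jacobi_summable_cmult jacobi_summable_const sm
  define g where "g = (\<lambda>t. (t powr 2 + (- 2 * x) * t powr 1) + x\<^sup>2)"
  have sg: "jacobi_summable \<alpha> \<beta> n k q g"
    unfolding g_def by (intro sms)
  have g: "(t - x)\<^sup>2 = g t" if "t \<in> {0<..<1}" for t
    using that by (simp add: g_def power2_eq_square algebra_simps)
  show s: "jacobi_summable \<alpha> \<beta> n k q (\<lambda>t. (t - x)\<^sup>2)"
    by (rule jacobi_summable_bounded[OF sg]) (simp add: g[symmetric])
  have "q_jacobi_coeff \<alpha> \<beta> n k q (\<lambda>t. (t - x)\<^sup>2) \<le> q_jacobi_coeff \<alpha> \<beta> n k q g"
    by (rule q_jacobi_coeff_mono[OF s sg]) (simp add: g)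
  also have "\<dots> = Q\<^sup>2 * (u * v) + (- 2 * x) * (Q * u) + x\<^sup>2"
    unfolding g_def
    by (simp only: sms q_jacobi_coeff_add q_jacobi_coeff_cmult q_jacobi_coeff_const
        q_jacobi_coeff_mean q_jacobi_coeff_square eqn u_def v_def Q_def add.assoc)
  also have "\<dots> = (p - x)\<^sup>2 + ((u - p) * v + p * (v - p)) - (1 - Q) * (1 + Q) * (u * v)
      - 2 * x * (u - p) + 2 * x * ((1 - Q) * u)"
    by (simp add: power2_eq_square algebra_simps)
  also have "\<dots> \<le> (p - x)\<^sup>2 + (e + e) - 0 + 2 * e + 2 * (1 - Q)"
  proof -
    have "(u - p) * v \<le> e * 1" using u v by (intro mult_mono) auto
    moreover have "(v - p) * p \<le> e * 1" using p v by (intro mult_mono) auto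
    moreover have "0 \<le> (1 - Q) * (1 + Q) * (u * v)" using Q u v by simp
    moreover have "(p - u) * (2 * x) \<le> e * (2 * 1)" using assms u by (intro mult_mono) auto
    moreover have "2 * x * ((1 - Q) * u) \<le> 2 * 1 * ((1 - Q) * 1)"
      using assms u Q by (intro mult_mono) auto
    ultimately show ?thesis by (simp add: algebra_simps)
  qed
  also have "\<dots> \<le> (p - x)\<^sup>2 + 4 * (e + (1 - Q))" using Q by simp
  finally show "q_jacobi_coeff \<alpha> \<beta> n k q (\<lambda>t. (t - x)\<^sup>2)
       \<le> (q_number q (real k) / q_number q (real n) - x)\<^sup>2
         + 4 * ((\<alpha> + \<beta> + 5) / q_number q (real n) + (1 - q powr (\<beta> + 1)))"
    unfolding p_def e_def Q_def .
qed

section \<open>Means of endpoint singularities\<close>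

text \<open>Up to constants the mean of \<open>t\<^sup>-\<^sup>a\<close> is at most \<open>([n + 1] / [k + 1])\<^sup>m\<close> in rising-product form, which is the
  expression summed by \<open>q_bernstein_negative_moment_success\<close>.\<close>

lemma q_jacobi_coeff_negative_power_at_0:
  assumes "k \<le> n" "0 < a" "a < \<alpha> + 1" "a \<le> real m"
  shows "q_jacobi_coeff \<alpha> \<beta> n k q (\<lambda>t. t powr - a)
     \<le> q powr (- a * (\<beta> + 1)) * (((1 + \<bar>\<alpha> + \<beta> + 2\<bar>) * (1 + 1 / (\<alpha> + 1 - a))) ^ m
         * (\<Prod>j<m. q_number q (real (n + 1 + j)) / q_number q (real (k + 1 + j))))"
proof -
  define C where "C = 1 + \<bar>\<alpha> + \<beta> + 2\<bar>"
  define D where "D = 1 + 1 / (\<alpha> + 1 - a)"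
  define s where "s = real k + \<alpha> + 1"
  define r where "r = real (n - k) + \<beta> + 1"
  have sr: "0 < s - a" "0 < s" "0 < r" using \<alpha> \<beta> assms by (auto simp: s_def r_def)
  have "q_jacobi_coeff \<alpha> \<beta> n k q (\<lambda>t. t powr - a)
     = q powr (- a * (\<beta> + 1)) * (beta_sum q (s - a) r / beta_sum q s r)"
    using jacobi_power(2)[of k "- a" n] assms unfolding s_def r_def by simp
  also have "beta_sum q (s - a) r / beta_sum q s r
      \<le> (\<Prod>j<m. (1 - q powr (s - a + r + real j)) / (1 - q powr (s - a + real j)))"
    using sr assms by (intro beta_sum_lower_s[OF q]) auto
  also have "\<dots> \<le> (\<Prod>j<m. C * D * (q_number q (real (n + 1 + j)) / q_number q (real (k + 1 + j))))"
  proof (intro prod_mono conjI q_number_ratio_le[OF q])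
    fix j
    show "0 \<le> (1 - q powr (s - a + r + real j)) / (1 - q powr (s - a + real j))"
      using powr_01[OF q, of "s - a + r + real j"] powr_01[OF q, of "s - a + real j"] sr by simp
    have "s - a + r + real j = real (n + 1 + j) + (\<alpha> + \<beta> + 1 - a)"
      using assms by (simp add: s_def r_def)
    also have "\<dots> \<le> real (n + 1 + j) + \<bar>\<alpha> + \<beta> + 2\<bar> * real (n + 1 + j)"
    proof -
      have "\<bar>\<alpha> + \<beta> + 2\<bar> * 1 \<le> \<bar>\<alpha> + \<beta> + 2\<bar> * real (n + 1 + j)" by (intro mult_left_mono) auto
      moreover have "\<alpha> + \<beta> + 1 - a \<le> \<bar>\<alpha> + \<beta> + 2\<bar> * 1" using assms by simp
      ultimately show ?thesis by (intro add_left_mono) (rule order_trans)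
    qed
    also have "\<dots> = C * real (n + 1 + j)" by (simp add: C_def algebra_simps)
    finally show "s - a + r + real j \<le> C * real (n + 1 + j)" .
    have "1 + real (k + j) \<le> D * (real (k + j) + (\<alpha> + 1 - a))"
    proof -
      have "0 \<le> real (k + j) * (1 / (\<alpha> + 1 - a))" using assms by simp
      moreover have "1 / (\<alpha> + 1 - a) * (\<alpha> + 1 - a) = 1" using assms by simp
      ultimately show ?thesis using assms unfolding D_def
        by (simp only: distrib_left distrib_right mult_1 mult.commute[of "1 / (\<alpha> + 1 - a)"])
    qed
    then show "real (k + 1 + j) \<le> D * (s - a + real j)" by (simp add: s_def algebra_simps)
  qed (use sr assms in \<open>auto simp: C_def D_def\<close>)
  also have "\<dots> = (C * D) ^ m * (\<Prod>j<m. q_number q (real (n + 1 + j)) / q_number q (real (k + 1 + j)))"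
    by (simp only: prod.distrib prod_constant card_lessThan power_mult_distrib)
  finally show ?thesis unfolding C_def D_def by (simp add: mult_left_mono)
qed

text \<open>The singularity at \<open>1\<close> is first replaced by its \<open>q\<close>-analogue, whose mean is at most a quotient of \<open>q\<close>-beta
  functions times \<open>q\<^sup>-\<^sup>m\<^sup>s\<close>; the quotient is then treated like the one at \<open>0\<close>, with \<open>n - k\<close> in place
  of \<open>k\<close>.\<close>

lemma jacobi_negative_power_at_1:
  assumes "k \<le> n" "0 < b" "b < \<beta> + 1" "b \<le> real m"
  shows "jacobi_summable \<alpha> \<beta> n k q (\<lambda>t. (1 - t) powr - b)"
   and "q_jacobi_coeff \<alpha> \<beta> n k q (\<lambda>t. (1 - t) powr - b)
     \<le> (1 + (1 + real m) / (\<beta> + 1)) powr b * q powr - (real m * (real n + \<alpha> + 1))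
        * (((1 + \<bar>\<alpha> + \<beta> + 2\<bar>) * (1 + 1 / (\<beta> + 1 - b))) ^ m
         * (\<Prod>j<m. q_number q (real (n + 1 + j)) / q_number q (real (n - k + 1 + j))))"
proof -
  define C where "C = 1 + \<bar>\<alpha> + \<beta> + 2\<bar>"
  define D where "D = 1 + 1 / (\<beta> + 1 - b)"
  define F where "F = 1 + (1 + real m) / (\<beta> + 1)"
  define s where "s = real k + \<alpha> + 1"
  define r where "r = real (n - k) + \<beta> + 1 - b"
  have F: "1 \<le> F" using \<beta> by (simp add: F_def)
  have sr: "0 < s" "0 < r" using \<alpha> \<beta> assms by (auto simp: s_def r_def)
  have rb: "real (n - k) + \<beta> + 1 = r + b" by (simp add: r_def)
  define w where "w = (\<lambda>i. beta_weight q s (r + b) i * (qphi q (real i + 1 + b) / qphi q (real i + 1)))"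
  have w: "summable w" "suminf w \<le> q powr - (real m * s) * beta_sum q s r"
    unfolding w_def using beta_weight_divide_qphi_ratio_le[OF q sr assms(2,4)] by auto
  \<comment> \<open>At the node \<open>t = q\<^sup>\<beta>\<^sup>+\<^sup>1\<^sup>+\<^sup>i\<close>, the function \<open>(1 - t)\<^sup>-\<^sup>b\<close> against \<open>1 / (1 - q\<^sup>i\<^sup>+\<^sup>1)\<^sub>q\<^sup>b\<close>.\<close>
  have node: "(1 - q powr (\<beta> + 1 + real i)) powr - b
      \<le> F powr b * (qphi q (real i + 1 + b) / qphi q (real i + 1))" for i
  proof -
    have pos: "0 < 1 - q powr (\<beta> + 1 + real i)" using node_01[of i] by simp
    have phi: "0 < qphi q (real i + 1)" "0 < qphi q (real i + 1 + b)"
      using assms by (auto intro!: qphi_pos[OF q])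
    have "real i + 1 + real m \<le> F * (\<beta> + 1 + real i)"
    proof -
      have "0 \<le> (1 + real m) / (\<beta> + 1) * real i" using \<beta> by simp
      moreover have "(1 + real m) / (\<beta> + 1) * (\<beta> + 1) = 1 + real m" using \<beta> by simp
      ultimately show ?thesis using \<beta> unfolding F_def
        by (simp only: distrib_left distrib_right mult_1)
    qed
    then have "1 - q powr (real i + 1 + real m) \<le> F * (1 - q powr (\<beta> + 1 + real i))"
      using F \<beta> by (intro one_minus_powr_le_mult[OF q]) auto
    moreover have "0 \<le> 1 - q powr (real i + 1 + real m)" using powr_01[OF q, of "real i + 1 + real m"] by simp
    ultimately have "(1 - q powr (real i + 1 + real m)) powr b \<le> (F * (1 - q powr (\<beta> + 1 + real i))) powr b"
      using assms by (intro powr_mono2) auto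
    also have "\<dots> = F powr b * (1 - q powr (\<beta> + 1 + real i)) powr b"
      using F pos by (simp add: powr_mult)
    finally have "qphi q (real i + 1) / qphi q (real i + 1 + b)
        \<le> F powr b * (1 - q powr (\<beta> + 1 + real i)) powr b"
      using qphi_ratio_le_powr[OF q _ assms(2,4), of "real i + 1"] by simp
    then show ?thesis using pos phi F by (simp add: powr_minus field_simps)
  qed
  have le: "beta_weight q s (r + b) i * (1 - q powr (\<beta> + 1 + real i)) powr - b \<le> F powr b * w i" for i
    using mult_left_mono[OF node[of i] less_imp_le[OF beta_weight_pos[OF q, of "r + b" s i]]] sr assms
    by (simp add: w_def mult.left_commute)
  have sm: "summable (\<lambda>i. beta_weight q s (r + b) i * (1 - q powr (\<beta> + 1 + real i)) powr - b)"
  proof (rule summable_comparison_test'[of "\<lambda>i. F powr b * w i" 0])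
    show "summable (\<lambda>i. F powr b * w i)" by (intro summable_mult w)
    show "norm (beta_weight q s (r + b) i * (1 - q powr (\<beta> + 1 + real i)) powr - b) \<le> F powr b * w i" for i
      using le[of i] beta_weight_pos[OF q, of "r + b" s i] sr assms by (simp add: abs_mult)
  qed
  then show "jacobi_summable \<alpha> \<beta> n k q (\<lambda>t. (1 - t) powr - b)"
    unfolding jacobi_summable_def rb s_def .
  have "(\<Sum>i. beta_weight q s (r + b) i * (1 - q powr (\<beta> + 1 + real i)) powr - b)
      \<le> (\<Sum>i. F powr b * w i)"
    by (intro suminf_le le sm summable_mult w)
  also have "\<dots> = F powr b * suminf w" by (intro suminf_mult w)
  also have "\<dots> \<le> F powr b * (q powr - (real m * s) * beta_sum q s r)"
    by (intro mult_left_mono w) simp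
  finally have "q_jacobi_coeff \<alpha> \<beta> n k q (\<lambda>t. (1 - t) powr - b)
     \<le> F powr b * (q powr - (real m * s) * beta_sum q s r) / beta_sum q s (r + b)"
    unfolding coeff_eq rb s_def[symmetric] using beta_sum_pos[OF q sr(1), of "r + b"] sr assms
    by (intro divide_right_mono) auto
  also have "\<dots> = F powr b * q powr - (real m * s) * (beta_sum q s r / beta_sum q s (r + b))"
    by simp
  also have "\<dots> \<le> F powr b * q powr - (real m * (real n + \<alpha> + 1))
      * (\<Prod>j<m. C * D * (q_number q (real (n + 1 + j)) / q_number q (real (n - k + 1 + j))))"
  proof (intro mult_mono)
    show "q powr - (real m * s) \<le> q powr - (real m * (real n + \<alpha> + 1))"
      using assms by (intro powr_antimono[OF q]) (simp add: s_def mult_left_mono)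
    have "beta_sum q s r / beta_sum q s (r + b)
      \<le> (\<Prod>j<m. (1 - q powr (s + r + real j)) / (1 - q powr (r + real j)))"
      using sr assms by (intro beta_sum_lower_r[OF q]) auto
    also have "\<dots> \<le> (\<Prod>j<m. C * D * (q_number q (real (n + 1 + j)) / q_number q (real (n - k + 1 + j))))"
    proof (intro prod_mono conjI q_number_ratio_le[OF q])
      fix j
      show "0 \<le> (1 - q powr (s + r + real j)) / (1 - q powr (r + real j))"
        using powr_01[OF q, of "s + r + real j"] powr_01[OF q, of "r + real j"] sr by simp
      have "s + r + real j = real (n + 1 + j) + (\<alpha> + \<beta> + 1 - b)"
        using assms by (simp add: s_def r_def)
      also have "\<dots> \<le> real (n + 1 + j) + \<bar>\<alpha> + \<beta> + 2\<bar> * real (n + 1 + j)"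
      proof -
        have "\<bar>\<alpha> + \<beta> + 2\<bar> * 1 \<le> \<bar>\<alpha> + \<beta> + 2\<bar> * real (n + 1 + j)" by (intro mult_left_mono) auto
        moreover have "\<alpha> + \<beta> + 1 - b \<le> \<bar>\<alpha> + \<beta> + 2\<bar> * 1" using assms by simp
        ultimately show ?thesis by (intro add_left_mono) (rule order_trans)
      qed
      also have "\<dots> = C * real (n + 1 + j)" by (simp add: C_def algebra_simps)
      finally show "s + r + real j \<le> C * real (n + 1 + j)" .
      have "1 + real (n - k + j) \<le> D * (real (n - k + j) + (\<beta> + 1 - b))"
      proof -
        have "0 \<le> real (n - k + j) * (1 / (\<beta> + 1 - b))" using assms by simp
        moreover have "1 / (\<beta> + 1 - b) * (\<beta> + 1 - b) = 1" using assms by simp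
        ultimately show ?thesis using assms unfolding D_def
          by (simp only: distrib_left distrib_right mult_1 mult.commute[of "1 / (\<beta> + 1 - b)"])
      qed
      then show "real (n - k + 1 + j) \<le> D * (r + real j)" by (simp add: r_def algebra_simps)
    qed (use sr assms in \<open>auto simp: C_def D_def\<close>)
    finally show "beta_sum q s r / beta_sum q s (r + b) \<le> \<dots>" .
    show "0 \<le> beta_sum q s r / beta_sum q s (r + b)"
      using beta_sum_pos[OF q sr] beta_sum_pos[OF q sr(1), of "r + b"] sr assms by simp
  qed auto
  also have "(\<Prod>j<m. C * D * (q_number q (real (n + 1 + j)) / q_number q (real (n - k + 1 + j))))
     = (C * D) ^ m * (\<Prod>j<m. q_number q (real (n + 1 + j)) / q_number q (real (n - k + 1 + j)))"
    by (simp only: prod.distrib prod_constant card_lessThan power_mult_distrib)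
  finally show "q_jacobi_coeff \<alpha> \<beta> n k q (\<lambda>t. (1 - t) powr - b)
     \<le> (1 + (1 + real m) / (\<beta> + 1)) powr b * q powr - (real m * (real n + \<alpha> + 1))
        * (((1 + \<bar>\<alpha> + \<beta> + 2\<bar>) * (1 + 1 / (\<beta> + 1 - b))) ^ m
         * (\<Prod>j<m. q_number q (real (n + 1 + j)) / q_number q (real (n - k + 1 + j))))"
    unfolding C_def D_def F_def .
qed

end

section \<open>A Korovkin criterion\<close>

lemma q_number_tendsto:
  assumes q: "\<And>n. 0 < q n" "\<And>n. q n < 1" and "q \<longlonglongrightarrow> 1"
  shows "(\<lambda>n. q_number (q n) (real m)) \<longlonglongrightarrow> real m"
proof (induction m)
  case 0
  then show ?case by (simp add: q_number_0 q)
next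
  case (Suc m)
  have "(\<lambda>n. 1 + q n * q_number (q n) (real m)) \<longlonglongrightarrow> 1 + 1 * real m"
    by (intro tendsto_intros assms Suc)
  then show ?case using q_number_Suc[OF q] by (simp del: of_nat_Suc) simp
qed

text \<open>For each fixed \<open>m \<le> n\<close> one has \<open>[n] \<ge> [m]\<close>, and \<open>[m]\<close> tends to \<open>m\<close> when \<open>q\<^sub>n\<close> tends to \<open>1\<close>.\<close>

lemma q_number_at_top:
  assumes q: "\<And>n. 0 < q n" "\<And>n. q n < 1" and "q \<longlonglongrightarrow> 1"
  shows "filterlim (\<lambda>n. q_number (q n) (real n)) at_top sequentially"
  unfolding filterlim_at_top
proof
  fix Z :: real
  obtain m :: nat where m: "Z < real m" using reals_Archimedean2 by blast
  have "eventually (\<lambda>n. Z < q_number (q n) (real m)) sequentially"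
    by (rule order_tendstoD(1)[OF q_number_tendsto[OF assms] m])
  then show "eventually (\<lambda>n. Z \<le> q_number (q n) (real n)) sequentially"
    using eventually_ge_at_top[of m]
  proof eventually_elim
    case (elim n)
    then show ?case using q_number_mono[OF q, of "real m" "real n" n] by simp
  qed
qed

text \<open>The quantitative Korovkin estimate. The operator is a positive average reproducing constants, so it
  suffices to average the three terms of the dominating function; the quadratic one is the second moment
  about \<open>x\<close>.\<close>

lemma q_durrmeyer_deviation:
  assumes q: "0 < q" "q < 1" and \<alpha>: "\<alpha> > -1" and \<beta>: "\<beta> > -1" and x: "0 < x" "x < 1" and n: "0 < n"
    and H: "\<And>k. k \<le> n \<Longrightarrow> jacobi_summable \<alpha> \<beta> n k q H"
    and K: "0 \<le> K"
    and le: "\<And>t. t \<in> {0<..<1} \<Longrightarrow> \<bar>f t - c\<bar> \<le> e + K * (t - x)\<^sup>2 + e * H t"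
  shows "\<bar>q_durrmeyer \<alpha> \<beta> n q f x - c\<bar>
    \<le> e + K * ((4 * (\<alpha> + \<beta> + 5) + 1) / q_number q (real n) + 4 * (1 - q powr (\<beta> + 1)))
        + e * q_durrmeyer \<alpha> \<beta> n q H x"
proof -
  define N where "N = q_number q (real n)"
  define d where "d = 4 * ((\<alpha> + \<beta> + 5) / N + (1 - q powr (\<beta> + 1)))"
  define w where "w = (\<lambda>k. q_bernstein n k q x)"
  have w: "0 < w k" for k unfolding w_def by (rule q_bernstein_pos[OF q x])
  have N: "0 < N" unfolding N_def using n by (intro q_number_pos[OF q]) simp
  have sw: "(\<Sum>k\<le>n. w k) = 1" unfolding w_def by (rule sum_q_bernstein[OF q x])
  have M: "q_durrmeyer \<alpha> \<beta> n q g x = (\<Sum>k\<le>n. q_jacobi_coeff \<alpha> \<beta> n k q g * w k)" for g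
    unfolding q_durrmeyer_def w_def by (simp add: atMost_atLeast0)
  have dev: "\<bar>q_jacobi_coeff \<alpha> \<beta> n k q f - c\<bar>
      \<le> e + K * ((q_number q (real k) / N - x)\<^sup>2 + d) + e * q_jacobi_coeff \<alpha> \<beta> n k q H" if "k \<le> n" for k
  proof -
    have sq: "jacobi_summable \<alpha> \<beta> n k q (\<lambda>t. (t - x)\<^sup>2)"
      and sq_le: "q_jacobi_coeff \<alpha> \<beta> n k q (\<lambda>t. (t - x)\<^sup>2) \<le> (q_number q (real k) / N - x)\<^sup>2 + d"
      using jacobi_squared_distance[OF q \<alpha> \<beta> that n, of x] x unfolding N_def d_def by auto
    note sms = jacobi_summable_add[OF q \<alpha> \<beta>] jacobi_summable_cmult[OF q \<alpha> \<beta>]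
      jacobi_summable_const[OF q \<alpha> \<beta>] sq H[OF that]
    have "\<bar>q_jacobi_coeff \<alpha> \<beta> n k q f - c\<bar>
       \<le> q_jacobi_coeff \<alpha> \<beta> n k q (\<lambda>t. e + K * (t - x)\<^sup>2 + e * H t)"
      by (intro q_jacobi_coeff_deviation[OF q \<alpha> \<beta>] sms le)
    also have "\<dots> = e + K * q_jacobi_coeff \<alpha> \<beta> n k q (\<lambda>t. (t - x)\<^sup>2) + e * q_jacobi_coeff \<alpha> \<beta> n k q H"
      by (simp only: sms q_jacobi_coeff_add[OF q \<alpha> \<beta>] q_jacobi_coeff_cmult[OF q \<alpha> \<beta>] q_jacobi_coeff_const[OF q \<alpha> \<beta>])
    finally show ?thesis using mult_left_mono[OF sq_le K] by simp
  qed
  have "\<bar>q_durrmeyer \<alpha> \<beta> n q f x - c\<bar> = \<bar>\<Sum>k\<le>n. (q_jacobi_coeff \<alpha> \<beta> n k q f - c) * w k\<bar>"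
    unfolding M left_diff_distrib sum_subtractf sum_distrib_left[symmetric] sw by simp
  also have "\<dots> \<le> (\<Sum>k\<le>n. \<bar>(q_jacobi_coeff \<alpha> \<beta> n k q f - c) * w k\<bar>)" by (rule sum_abs)
  also have "\<dots> \<le> (\<Sum>k\<le>n. (e + K * ((q_number q (real k) / N - x)\<^sup>2 + d) + e * q_jacobi_coeff \<alpha> \<beta> n k q H) * w k)"
    using dev w by (intro sum_mono) (simp add: abs_mult mult_right_mono less_imp_le)
  also have "\<dots> = (\<Sum>k\<le>n. (e + K * d) * w k + K * ((q_number q (real k) / N - x)\<^sup>2 * w k)
       + e * (q_jacobi_coeff \<alpha> \<beta> n k q H * w k))"
    by (intro sum.cong refl) (simp add: algebra_simps)
  also have "\<dots> = (e + K * d) + K * (x * (1 - x) / N) + e * q_durrmeyer \<alpha> \<beta> n q H x"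
    unfolding sum.distrib sum_distrib_left[symmetric] sw M
    using q_bernstein_variance[OF q x n] by (simp add: w_def N_def)
  also have "x * (1 - x) / N \<le> 1 / N"
    using x N by (intro divide_right_mono) (auto intro!: mult_le_one)
  finally have "\<bar>q_durrmeyer \<alpha> \<beta> n q f x - c\<bar> \<le> (e + K * d) + K * (1 / N) + e * q_durrmeyer \<alpha> \<beta> n q H x"
    using K by (simp add: mult_left_mono)
  also have "(e + K * d) + K * (1 / N)
      = e + K * ((4 * (\<alpha> + \<beta> + 5) + 1) / N + 4 * (1 - q powr (\<beta> + 1)))"
    using N unfolding d_def by (simp add: field_simps)
  finally show ?thesis unfolding N_def .
qed

lemma q_durrmeyer_negative_power_at_0:
  assumes q: "0 < q" "q < 1" and \<alpha>: "\<alpha> > -1" and \<beta>: "\<beta> > -1" and x: "0 < x" "x < 1"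
    and a: "0 < a" "a < \<alpha> + 1" "a \<le> real m"
  shows "q_durrmeyer \<alpha> \<beta> n q (\<lambda>t. t powr - a) x
    \<le> q powr (- a * (\<beta> + 1)) * ((1 + \<bar>\<alpha> + \<beta> + 2\<bar>) * (1 + 1 / (\<alpha> + 1 - a))) ^ m * (1 / x ^ m)"
proof -
  define C where "C = q powr (- a * (\<beta> + 1)) * ((1 + \<bar>\<alpha> + \<beta> + 2\<bar>) * (1 + 1 / (\<alpha> + 1 - a))) ^ m"
  have C: "0 \<le> C" unfolding C_def using a by simp
  have "q_durrmeyer \<alpha> \<beta> n q (\<lambda>t. t powr - a) x
      \<le> (\<Sum>k\<le>n. C * ((\<Prod>j<m. q_number q (real (n + 1 + j)) / q_number q (real (k + 1 + j))) * q_bernstein n k q x))"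
    unfolding q_durrmeyer_def atMost_atLeast0 mult.assoc[symmetric] C_def
    using q_jacobi_coeff_negative_power_at_0[OF q \<alpha> \<beta> _ a] less_imp_le[OF q_bernstein_pos[OF q x]]
    by (intro sum_mono mult_right_mono) (simp_all add: mult.assoc)
  also have "\<dots> \<le> C * (1 / x ^ m)"
    unfolding sum_distrib_left[symmetric]
    by (intro mult_left_mono q_bernstein_negative_moment_success[OF q x] C)
  finally show ?thesis unfolding C_def .
qed

lemma q_durrmeyer_negative_power_at_1:
  assumes q: "0 < q" "q < 1" and \<alpha>: "\<alpha> > -1" and \<beta>: "\<beta> > -1" and x: "0 < x" "x < 1"
    and b: "0 < b" "b < \<beta> + 1" "b \<le> real m"
  shows "q_durrmeyer \<alpha> \<beta> n q (\<lambda>t. (1 - t) powr - b) x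
    \<le> (1 + (1 + real m) / (\<beta> + 1)) powr b * q powr - (real m * (real n + \<alpha> + 1))
      * ((1 + \<bar>\<alpha> + \<beta> + 2\<bar>) * (1 + 1 / (\<beta> + 1 - b))) ^ m * (1 / (1 - x) ^ m)"
proof -
  define C where "C = (1 + (1 + real m) / (\<beta> + 1)) powr b * q powr - (real m * (real n + \<alpha> + 1))
      * ((1 + \<bar>\<alpha> + \<beta> + 2\<bar>) * (1 + 1 / (\<beta> + 1 - b))) ^ m"
  have C: "0 \<le> C" unfolding C_def using b by simp
  have "q_durrmeyer \<alpha> \<beta> n q (\<lambda>t. (1 - t) powr - b) x
      \<le> (\<Sum>k\<le>n. C * ((\<Prod>j<m. q_number q (real (n + 1 + j)) / q_number q (real (n - k + 1 + j))) * q_bernstein n k q x))"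
    unfolding q_durrmeyer_def atMost_atLeast0 mult.assoc[symmetric] C_def
    using jacobi_negative_power_at_1(2)[OF q \<alpha> \<beta> _ b] less_imp_le[OF q_bernstein_pos[OF q x]]
    by (intro sum_mono mult_right_mono) (simp_all add: mult.assoc)
  also have "\<dots> \<le> C * (1 / (1 - x) ^ m)"
    unfolding sum_distrib_left[symmetric]
    by (intro mult_left_mono q_bernstein_negative_moment_failure[OF q x] C)
  finally show ?thesis unfolding C_def .
qed

text \<open>Here \<open>H\<close> is any function whose images under the operators stay bounded at \<open>x\<close>. Since a small multiple of it
  is allowed in the estimate of the deviation, \<open>f\<close> may be unbounded as long as it is of smaller order than \<open>H\<close>
  near the singularities of \<open>H\<close>.\<close>

lemma q_durrmeyer_tendsto:
  assumes q: "\<And>n. 0 < q n" "\<And>n. q n < 1" "q \<longlonglongrightarrow> 1"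
    and \<alpha>: "\<alpha> > -1" and \<beta>: "\<beta> > -1" and x: "0 < x" "x < 1"
    and H: "\<And>n k. k \<le> n \<Longrightarrow> jacobi_summable \<alpha> \<beta> n k (q n) H"
    and L: "0 \<le> L" "eventually (\<lambda>n. q_durrmeyer \<alpha> \<beta> n (q n) H x \<le> L) sequentially"
    and le: "\<And>e. 0 < e \<Longrightarrow> \<exists>K\<ge>0. \<forall>t\<in>{0<..<1}. \<bar>f t - c\<bar> \<le> e + K * (t - x)\<^sup>2 + e * H t"
  shows "(\<lambda>n. q_durrmeyer \<alpha> \<beta> n (q n) f x) \<longlonglongrightarrow> c"
proof (rule tendstoI)
  fix \<epsilon> :: real assume \<epsilon>: "0 < \<epsilon>"
  \<comment> \<open>Chosen so that \<open>e + e L = \<epsilon> / 2\<close>, which leaves room for the quadratic term.\<close>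
  define e where "e = \<epsilon> / (2 * (1 + L))"
  have "e * (1 + L) = \<epsilon> / 2" using L by (simp add: e_def field_simps)
  then have "e * (1 + L) < \<epsilon>" using \<epsilon> by linarith
  moreover have "0 < e" using \<epsilon> L by (simp add: e_def)
  ultimately have e: "0 < e" "e * (1 + L) < \<epsilon>" by simp_all
  obtain K where K: "0 \<le> K" "\<And>t. t \<in> {0<..<1} \<Longrightarrow> \<bar>f t - c\<bar> \<le> e + K * (t - x)\<^sup>2 + e * H t"
    using le[OF e(1)] by blast
  let ?d = "\<lambda>n. (4 * (\<alpha> + \<beta> + 5) + 1) / q_number (q n) (real n) + 4 * (1 - q n powr (\<beta> + 1))"
  have "(\<lambda>n. (4 * (\<alpha> + \<beta> + 5) + 1) / q_number (q n) (real n)) \<longlonglongrightarrow> 0"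
    using q_number_at_top[OF q] by (intro tendsto_divide_0[OF tendsto_const] filterlim_at_top_imp_at_infinity)
  moreover have "(\<lambda>n. q n powr (\<beta> + 1)) \<longlonglongrightarrow> 1 powr (\<beta> + 1)"
    by (intro tendsto_powr q tendsto_const) simp
  ultimately have "(\<lambda>n. e * (1 + L) + K * ?d n) \<longlonglongrightarrow> e * (1 + L) + K * (0 + 4 * (1 - 1 powr (\<beta> + 1)))"
    by (intro tendsto_add[OF tendsto_const] tendsto_mult[OF tendsto_const] tendsto_add tendsto_diff[OF tendsto_const])
  then have "(\<lambda>n. e * (1 + L) + K * ?d n) \<longlonglongrightarrow> e * (1 + L)" by simp
  from order_tendstoD(2)[OF this e(2)] L(2) eventually_gt_at_top[of 0]
  show "eventually (\<lambda>n. dist (q_durrmeyer \<alpha> \<beta> n (q n) f x) c < \<epsilon>) sequentially"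
  proof eventually_elim
    case (elim n)
    have "\<bar>q_durrmeyer \<alpha> \<beta> n (q n) f x - c\<bar> \<le> e + K * ?d n + e * q_durrmeyer \<alpha> \<beta> n (q n) H x"
      using q_durrmeyer_deviation[OF q(1,2) \<alpha> \<beta> x elim(3) H K] by simp
    also have "\<dots> \<le> e + K * ?d n + e * L" using elim e by simp
    also have "\<dots> < \<epsilon>" using elim by (simp add: algebra_simps)
    finally show ?case by (simp add: dist_real_def)
  qed
qed

section \<open>Domination of singular functions\<close>

text \<open>Below \<open>\<tau> = e\<^sup>1\<^sup>/\<^sup>(\<^sup>a\<^sup>-\<^sup>a'\<^sup>)\<close> the stronger singularity wins, and above \<open>\<tau>\<close> the left-hand side is bounded.\<close>

lemma powr_le_small_multiple_plus_const:
  assumes "0 \<le> a'" "a' < a" "0 < (e::real)"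
  obtains C where "0 \<le> C" "\<And>t. 0 < t \<Longrightarrow> t powr - a' \<le> e * t powr - a + C"
proof
  define \<tau> where "\<tau> = e powr (1 / (a - a'))"
  have \<tau>: "0 < \<tau>" "\<tau> powr (a - a') = e" using assms by (auto simp: \<tau>_def powr_powr)
  show "0 \<le> \<tau> powr - a'" by simp
  fix t :: real assume t: "0 < t"
  show "t powr - a' \<le> e * t powr - a + \<tau> powr - a'"
  proof (cases "t \<le> \<tau>")
    case True
    have "t powr - a' = t powr (a - a') * t powr - a" by (simp add: powr_add[symmetric])
    also have "t powr (a - a') \<le> e"
      using powr_mono2[of "a - a'" t \<tau>] True t assms \<tau> by simp
    finally have "t powr - a' \<le> e * t powr - a" by (simp add: mult_right_mono)
    then show ?thesis by (simp add: add_increasing2)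
  next
    case False
    then have "t powr - a' \<le> \<tau> powr - a'" using \<tau> assms by (intro powr_mono2') auto
    then show ?thesis using assms by (simp add: add_increasing)
  qed
qed

lemma beta_singularity_le:
  assumes "0 \<le> a'" "a' < a" "0 \<le> b'" "b' < b" "0 < (e::real)"
  obtains C where "0 \<le> C"
    "\<And>t. t \<in> {0<..<1} \<Longrightarrow> t powr - a' * (1 - t) powr - b' \<le> e * (t powr - a + (1 - t) powr - b) + C"
proof -
  define A B where "A = (1/2::real) powr - a'" and "B = (1/2::real) powr - b'"
  have AB: "0 < A" "0 < B" by (auto simp: A_def B_def)
  obtain C1 where C1: "0 \<le> C1" "\<And>t. 0 < t \<Longrightarrow> t powr - a' \<le> e / B * t powr - a + C1"
    using powr_le_small_multiple_plus_const[OF assms(1,2), of "e / B"] assms AB by auto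
  obtain C2 where C2: "0 \<le> C2" "\<And>t. 0 < t \<Longrightarrow> t powr - b' \<le> e / A * t powr - b + C2"
    using powr_le_small_multiple_plus_const[OF assms(3,4), of "e / A"] assms AB by auto
  show thesis
  proof
    show "0 \<le> B * C1 + A * C2" using C1 C2 AB by simp
    fix t :: real assume t: "t \<in> {0<..<1}"
    show "t powr - a' * (1 - t) powr - b' \<le> e * (t powr - a + (1 - t) powr - b) + (B * C1 + A * C2)"
    proof (cases "t \<le> 1/2")
      case True
      have "t powr - a' * (1 - t) powr - b' \<le> (e / B * t powr - a + C1) * B"
        unfolding B_def using True t C1 AB assms
        by (intro mult_mono powr_mono2') (auto simp: B_def)
      also have "\<dots> = e * t powr - a + B * C1" using AB by (simp add: field_simps)
      also have "\<dots> \<le> e * (t powr - a + (1 - t) powr - b) + (B * C1 + A * C2)"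
        using assms AB C2 by (intro add_mono mult_left_mono) auto
      finally show ?thesis .
    next
      case False
      have "t powr - a' * (1 - t) powr - b' \<le> A * (e / A * (1 - t) powr - b + C2)"
        unfolding A_def using False t C2 AB assms
        by (intro mult_mono powr_mono2') (auto simp: A_def)
      also have "\<dots> = e * (1 - t) powr - b + A * C2" using AB by (simp add: field_simps)
      also have "\<dots> \<le> e * (t powr - a + (1 - t) powr - b) + (B * C1 + A * C2)"
        using assms AB C1 by (intro add_mono mult_left_mono) auto
      finally show ?thesis .
    qed
  qed
qed

text \<open>Near \<open>x\<close> the constant \<open>e\<close> is enough by continuity. At distance at least \<open>d\<close> from \<open>x\<close> the bounded part
  \<open>C + \<bar>f x\<bar>\<close> is below a multiple of \<open>(t - x)\<^sup>2 / d\<^sup>2\<close>.\<close>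

lemma isCont_quadratic_domination:
  fixes f H :: "real \<Rightarrow> real"
  assumes "isCont f x" "0 < e" "\<And>t. t \<in> {0<..<1} \<Longrightarrow> \<bar>f t\<bar> \<le> e * H t + C"
    and H: "\<And>t. t \<in> {0<..<1} \<Longrightarrow> 0 \<le> H t" and C: "0 \<le> C"
  shows "\<exists>K\<ge>0. \<forall>t\<in>{0<..<1}. \<bar>f t - f x\<bar> \<le> e + K * (t - x)\<^sup>2 + e * H t"
proof -
  obtain d where d: "0 < d" "\<And>t. \<bar>t - x\<bar> < d \<Longrightarrow> \<bar>f t - f x\<bar> < e"
    using assms(1,2) unfolding continuous_at_eps_delta by (auto simp: dist_real_def)
  define K where "K = (C + \<bar>f x\<bar>) / d\<^sup>2"
  have K: "0 \<le> K" using C by (simp add: K_def)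
  have "\<bar>f t - f x\<bar> \<le> e + K * (t - x)\<^sup>2 + e * H t" if t: "t \<in> {0<..<1}" for t
  proof (cases "\<bar>t - x\<bar> < d")
    case True
    have "0 \<le> K * (t - x)\<^sup>2" "0 \<le> e * H t" using K H[OF t] assms(2) by auto
    then show ?thesis using d(2)[OF True] by linarith
  next
    case False
    then have "d\<^sup>2 \<le> (t - x)\<^sup>2" using d(1) power_mono[of d "\<bar>t - x\<bar>" 2] by simp
    then have "K * d\<^sup>2 \<le> K * (t - x)\<^sup>2" using K by (rule mult_left_mono)
    moreover have "K * d\<^sup>2 = C + \<bar>f x\<bar>" using d(1) by (simp add: K_def)
    ultimately show ?thesis using assms(3)[OF t] assms(2) by linarith
  qed
  then show ?thesis using K by blast
qed

lemma property_S_imp_tendsto_1: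
  assumes "property_S q" "\<And>n. q n < 1"
  shows "q \<longlonglongrightarrow> 1"
proof -
  obtain N c where c: "\<And>n. n > N \<Longrightarrow> 1 - q n < c / real n"
    using assms(1) unfolding property_S_def by blast
  have "(\<lambda>n. 1 - c / real n) \<longlonglongrightarrow> 1 - 0"
    by (intro tendsto_diff tendsto_const lim_const_over_n)
  then have lim: "(\<lambda>n. 1 - c / real n) \<longlonglongrightarrow> 1" by simp
  show ?thesis
  proof (rule tendsto_sandwich[OF _ _ lim tendsto_const])
    show "eventually (\<lambda>n. 1 - c / real n \<le> q n) sequentially"
      using eventually_gt_at_top[of N]
    proof eventually_elim
      case (elim n)
      then show ?case using c[of n] by linarith
    qed
    show "eventually (\<lambda>n. q n \<le> 1) sequentially" using assms(2) by (simp add: less_imp_le)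
  qed
qed

text \<open>If \<open>q\<^sub>n > 1/2\<close> then \<open>- ln q\<^sub>n \<le> 2 (1 - q\<^sub>n) < 2 c / n\<close>, so \<open>q\<^sub>n\<close> to a power of order \<open>n\<close> stays away
  from \<open>0\<close>.\<close>

lemma property_S_imp_power_bound:
  assumes "property_S q" "\<And>n. 0 < q n" "\<And>n. q n < 1" "0 < d"
  obtains B where "0 \<le> B" "eventually (\<lambda>n. q n powr - (real m * (real n + d)) \<le> B) sequentially"
proof -
  obtain N c where c: "0 < c" "\<And>n. n > N \<Longrightarrow> 1 - q n < c / real n"
    using assms(1) unfolding property_S_def by blast
  define B where "B = exp (real m * (2 * c * (1 + d)))"
  have "eventually (\<lambda>n. 1 / 2 < q n) sequentially"
    using order_tendstoD(1)[OF property_S_imp_tendsto_1[OF assms(1,3)], of "1/2"] by simp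
  then have "eventually (\<lambda>n. q n powr - (real m * (real n + d)) \<le> B) sequentially"
    using eventually_gt_at_top[of N] eventually_gt_at_top[of 0]
  proof eventually_elim
    case (elim n)
    have "ln (1 / q n) \<le> 1 / q n - 1" using assms(2)[of n] by (intro ln_le_minus_one) simp
    also have "\<dots> = (1 - q n) / q n" using assms(2)[of n] by (simp add: field_simps)
    also have "\<dots> \<le> (c / real n) / (1 / 2)"
      using elim c(2)[of n] assms(3)[of n] by (intro frac_le) auto
    finally have "- ln (q n) \<le> 2 * c / real n" using assms(2)[of n] by (simp add: ln_div mult.commute)
    then have "(real n + d) * (- ln (q n)) \<le> (real n + d) * (2 * c / real n)"
      using assms(4) by (intro mult_left_mono) auto
    also have "\<dots> = 2 * c * (1 + d / real n)" using elim by (simp add: field_simps)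
    also have "\<dots> \<le> 2 * c * (1 + d)"
      using c(1) elim assms(4) by (intro mult_left_mono add_left_mono) (auto simp: divide_le_eq)
    finally have "real m * ((real n + d) * (- ln (q n))) \<le> real m * (2 * c * (1 + d))"
      by (intro mult_left_mono) auto
    then show ?case using assms(2)[of n] unfolding B_def by (simp add: powr_def mult.assoc)
  qed
  then show ?thesis using that[of B] by (simp add: B_def)
qed

lemma q_durrmeyer_add:
  assumes q: "0 < q" "q < 1" and \<alpha>: "\<alpha> > -1" and \<beta>: "\<beta> > -1"
    and "\<And>k. k \<le> n \<Longrightarrow> jacobi_summable \<alpha> \<beta> n k q f" "\<And>k. k \<le> n \<Longrightarrow> jacobi_summable \<alpha> \<beta> n k q g"
  shows "q_durrmeyer \<alpha> \<beta> n q (\<lambda>t. f t + g t) x = q_durrmeyer \<alpha> \<beta> n q f x + q_durrmeyer \<alpha> \<beta> n q g x"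
  unfolding q_durrmeyer_def sum.distrib[symmetric]
  using assms by (intro sum.cong refl) (simp add: q_jacobi_coeff_add distrib_right)

section \<open>Convergence of the operators\<close>

theorem theorem3:
  fixes \<alpha> \<beta> x :: real and q :: "nat \<Rightarrow> real" and f :: "real \<Rightarrow> real"
  assumes "\<alpha> > -1" and "\<beta> > -1"
    and "x \<in> {0<..<1}"
    and "\<And>n. q n \<in> {0<..<1}"
    and "isCont f x"
    and "(bounded (f ` {0..1}) \<and> q \<longlonglongrightarrow> 1) \<or>
         ((\<exists>\<alpha>' \<beta>' \<kappa>'. \<alpha>' \<ge> 0 \<and> \<beta>' \<ge> 0 \<and> \<kappa>' > 0 \<and>
             (\<forall>t\<in>{0<..<1}. \<bar>t powr \<alpha>' * (1 - t) powr \<beta>' * f t\<bar> \<le> \<kappa>') \<and>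
             \<alpha>' < \<alpha> + 1 \<and> \<beta>' < \<beta> + 1) \<and>
          property_S q)"
  shows "(\<lambda>n. q_durrmeyer \<alpha> \<beta> n (q n) f x) \<longlonglongrightarrow> f x"
proof -
  have x: "0 < x" "x < 1" using assms(3) by auto
  have q: "0 < q n" "q n < 1" for n using assms(4)[of n] by auto
  from assms(6) show ?thesis
  proof (elim disjE conjE exE)
    assume "bounded (f ` {0..1})" and lim: "q \<longlonglongrightarrow> 1"
    then obtain C where "\<forall>y\<in>f ` {0..1}. norm y \<le> C"
      by (auto simp: bounded_iff)
    then have C: "\<bar>f t\<bar> \<le> C" if "t \<in> {0..1}" for t using that by simp
    have "0 \<le> C" using C[of 0] by simp
    show ?thesis
    proof (rule q_durrmeyer_tendsto[OF q lim assms(1,2) x, where H = "\<lambda>t. 0" and L = 0])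
      show "\<exists>K\<ge>0. \<forall>t\<in>{0<..<1}. \<bar>f t - f x\<bar> \<le> e + K * (t - x)\<^sup>2 + e * 0" if "0 < e" for e
        using C \<open>0 \<le> C\<close> by (intro isCont_quadratic_domination[OF assms(5) that, where C = C]) auto
    qed (auto simp: jacobi_summable_def q_durrmeyer_def q_jacobi_coeff_eq[OF q assms(1,2)])
  next
    fix a' b' \<kappa>
    assume a': "0 \<le> a'" "a' < \<alpha> + 1" and b': "0 \<le> b'" "b' < \<beta> + 1" and \<kappa>: "0 < \<kappa>"
      and f: "\<forall>t\<in>{0<..<1}. \<bar>t powr a' * (1 - t) powr b' * f t\<bar> \<le> \<kappa>" and S: "property_S q"
    \<comment> \<open>Exponents strictly between those of \<open>f\<close> and the critical ones: near the endpoints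
      \<open>H\<close> then dominates \<open>f\<close> with an arbitrarily small factor, while its means remain finite.\<close>
    define a b where "a = (a' + (\<alpha> + 1)) / 2" and "b = (b' + (\<beta> + 1)) / 2"
    have a: "a' < a" "0 < a" "a < \<alpha> + 1" using a' by (auto simp: a_def)
    have b: "b' < b" "0 < b" "b < \<beta> + 1" using b' by (auto simp: b_def)
    obtain m :: nat where "max a b < real m" using reals_Archimedean2 by blast
    then have m: "a \<le> real m" "b \<le> real m" by auto
    have lim: "q \<longlonglongrightarrow> 1" using property_S_imp_tendsto_1[OF S q(2)] .
    define H where "H = (\<lambda>t. t powr - a + (1 - t) powr - b)"
    have H0: "jacobi_summable \<alpha> \<beta> n k (q n) (\<lambda>t. t powr - a)"
      and H1: "k \<le> n \<Longrightarrow> jacobi_summable \<alpha> \<beta> n k (q n) (\<lambda>t. (1 - t) powr - b)" for n k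
      using jacobi_power(1)[OF q assms(1,2), of k "- a"] a
        jacobi_negative_power_at_1(1)[OF q assms(1,2) _ b(2,3) m(2)] by auto
    define C0 where "C0 = ((1 + \<bar>\<alpha> + \<beta> + 2\<bar>) * (1 + 1 / (\<alpha> + 1 - a))) ^ m * (1 / x ^ m)"
    define C1 where "C1 = (1 + (1 + real m) / (\<beta> + 1)) powr b
       * (((1 + \<bar>\<alpha> + \<beta> + 2\<bar>) * (1 + 1 / (\<beta> + 1 - b))) ^ m * (1 / (1 - x) ^ m))"
    have C01: "0 \<le> C0" "0 \<le> C1" unfolding C0_def C1_def using a b x by auto
    obtain B where B: "0 \<le> B"
      "eventually (\<lambda>n. q n powr - (real m * (real n + (\<alpha> + 1))) \<le> B) sequentially"
      using property_S_imp_power_bound[OF S q, of "\<alpha> + 1" m] assms(1) by auto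
    have "(\<lambda>n. q n powr (- a * (\<beta> + 1))) \<longlonglongrightarrow> 1 powr (- a * (\<beta> + 1))"
      by (intro tendsto_powr lim tendsto_const) simp
    then have "eventually (\<lambda>n. q n powr (- a * (\<beta> + 1)) < 2) sequentially"
      by (intro order_tendstoD(2)) auto
    with B(2) have ev: "eventually (\<lambda>n. q_durrmeyer \<alpha> \<beta> n (q n) H x \<le> 2 * C0 + B * C1) sequentially"
    proof eventually_elim
      case (elim n)
      have "q_durrmeyer \<alpha> \<beta> n (q n) H x = q_durrmeyer \<alpha> \<beta> n (q n) (\<lambda>t. t powr - a) x
          + q_durrmeyer \<alpha> \<beta> n (q n) (\<lambda>t. (1 - t) powr - b) x"
        unfolding H_def by (intro q_durrmeyer_add[OF q assms(1,2)] H0 H1)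
      also have "\<dots> \<le> q n powr (- a * (\<beta> + 1)) * C0 + q n powr - (real m * (real n + (\<alpha> + 1))) * C1"
        unfolding C0_def C1_def
        using q_durrmeyer_negative_power_at_0[OF q assms(1,2) x a(2,3) m(1), of n n]
          q_durrmeyer_negative_power_at_1[OF q assms(1,2) x b(2,3) m(2), of n n]
        by (simp add: mult_ac add_ac)
      also have "\<dots> \<le> 2 * C0 + B * C1"
        using elim C01 by (intro add_mono mult_right_mono) auto
      finally show ?case .
    qed
    show ?thesis
    proof (rule q_durrmeyer_tendsto[OF q lim assms(1,2) x _ _ ev])
      show "jacobi_summable \<alpha> \<beta> n k (q n) H" if "k \<le> n" for n k
        unfolding H_def by (intro jacobi_summable_add[OF q assms(1,2)] H0 H1 that)
      show "0 \<le> 2 * C0 + B * C1" using B C01 by simp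
      fix e :: real assume e: "0 < e"
      then have "0 < e / \<kappa>" using \<kappa> by simp
      from beta_singularity_le[OF a'(1) a(1) b'(1) b(1) this] obtain C where C: "0 \<le> C"
        "\<And>t. t \<in> {0<..<1} \<Longrightarrow> t powr - a' * (1 - t) powr - b' \<le> e / \<kappa> * H t + C"
        unfolding H_def by metis
      show "\<exists>K\<ge>0. \<forall>t\<in>{0<..<1}. \<bar>f t - f x\<bar> \<le> e + K * (t - x)\<^sup>2 + e * H t"
      proof (rule isCont_quadratic_domination[OF assms(5) e, where C = "\<kappa> * C"])
        fix t :: real assume t: "t \<in> {0<..<1}"
        have pos: "0 < t powr a'" "0 < (1 - t) powr b'" using t by auto
        have "t powr a' * (1 - t) powr b' * \<bar>f t\<bar> \<le> \<kappa>"
          using bspec[OF f t] pos by (simp add: abs_mult)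
        then have "\<bar>f t\<bar> \<le> \<kappa> * (t powr - a' * (1 - t) powr - b')"
          using pos by (simp add: powr_minus field_simps)
        also have "\<dots> \<le> \<kappa> * (e / \<kappa> * H t + C)" using C(2)[OF t] \<kappa> by (intro mult_left_mono) auto
        also have "\<dots> = e * H t + \<kappa> * C" using \<kappa> by (simp add: field_simps)
        finally show "\<bar>f t\<bar> \<le> e * H t + \<kappa> * C" .
        show "0 \<le> H t" by (simp add: H_def)
      qed (use C \<kappa> in simp)
    qed
  qed
qed

end
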